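(* Let $N_t$ be the self-exciting point process with rate function $\lambda$ and initial condition $\gamma\ge 0$. Assume that $\lambda$ is increasing and $\alpha$-Lipschitz for some $0<\alpha<1$. Let $x^{\ast}$ be the unique solution of the equation $x=\lambda(x)$ (with $x^{\ast}=\infty$ if no solution exists). Then $$\frac{N_t}{t}\to x^{\ast}\quad\text{in probability as } t\to\infty.$$ If, in addition, $\lambda(\cdot)\le C_0$ for some constant $C_0<\infty$, then the convergence holds almost surely.
   Context: Model: $\lambda:\mathbb{R}_{\ge 0}\to\mathbb{R}_{\ge 0}$ and $\gamma\ge 0$ are given; $N_t$ is a simple point process on $(0,\infty)$ with $N_0=0$ (empty past history) whose intensity at time $t$ with respect to its natural filtration is $\lambda_t=\lambda\left(\frac{N_{t-}+\gamma}{t+1}\right)$. Standing assumptions: $\lambda$ is increasing and continuously differentiable; the equation $x=\lambda(x)$ has finitely many solutions, and each solution $x^*$ satisfies either $\lambda'(x^* )<1$ or $\lambda'(x^* )>1$. *)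

theory Defs
  imports "HOL-Probability.Probability"
begin

text \<open>
  A point process on the half line \<open>(0, \<infinity>)\<close> is represented by its random set \<open>S \<omega>\<close> of points.
  Points of a set have no multiplicity, so the process is automatically simple, and \<open>N\<^sub>0 = 0\<close>
  (empty past history) because no point lies in \<open>(0, 0]\<close>.
\<close>

definition count_upto :: "('a \<Rightarrow> real set) \<Rightarrow> real \<Rightarrow> 'a \<Rightarrow> nat"
  where "count_upto S t \<omega> = card (S \<omega> \<inter> {0<..t})"

text \<open>The left limit \<open>N\<^bsub>t-\<^esub>\<close>.\<close>

definition count_before :: "('a \<Rightarrow> real set) \<Rightarrow> real \<Rightarrow> 'a \<Rightarrow> nat"
  where "count_before S t \<omega> = card (S \<omega> \<inter> {0<..<t})"

text \<open>
  Local finiteness says that \<open>N\<^sub>t\<close> is finite for every \<open>t\<close>; it also rules out the convention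
  that \<open>card\<close> is \<open>0\<close> on infinite sets from having any effect.
\<close>

definition simple_point_process :: "'a measure \<Rightarrow> ('a \<Rightarrow> real set) \<Rightarrow> bool"
  where "simple_point_process M S \<longleftrightarrow>
    (\<forall>\<omega>\<in>space M. S \<omega> \<subseteq> {0<..} \<and> (\<forall>t. finite (S \<omega> \<inter> {0<..t}))) \<and>
    (\<forall>t. count_upto S t \<in> measurable M (count_space UNIV))"

definition natural_filtration :: "'a measure \<Rightarrow> ('a \<Rightarrow> real set) \<Rightarrow> real \<Rightarrow> 'a measure"
  where "natural_filtration M S t =
    sigma (space M) {count_upto S u -` A \<inter> space M | u A. 0 \<le> u \<and> u \<le> t}"

definition predictable_algebra :: "'a set \<Rightarrow> (real \<Rightarrow> 'a measure) \<Rightarrow> (real \<times> 'a) measure"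
  where "predictable_algebra \<Omega> F =
    sigma ({0<..} \<times> \<Omega>) {{a<..b} \<times> A | a b A. 0 \<le> a \<and> a \<le> b \<and> A \<in> sets (F a)}"

definition progressively_measurable :: "(real \<Rightarrow> 'a measure) \<Rightarrow> (real \<Rightarrow> 'a \<Rightarrow> real) \<Rightarrow> bool"
  where "progressively_measurable F L \<longleftrightarrow>
    (\<forall>t\<ge>0. (\<lambda>(s, \<omega>). L s \<omega>) \<in> borel_measurable (restrict_space borel {0..t} \<Otimes>\<^sub>M F t))"

text \<open>
  Stochastic intensity in the sense of Bremaud: for every nonnegative predictable process \<open>C\<close>,
  \<open>E \<integral> C\<^sub>s dN\<^sub>s = E \<integral> C\<^sub>s L\<^sub>s ds\<close>. The integral with respect to \<open>dN\<close> is the sum of \<open>C\<close> over the points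
  of the process. Testing only against the generators \<open>(a, b] \<times> A\<close> would not suffice without an
  integrability assumption on \<open>N\<close>, since both sides could be infinite.
\<close>

definition has_intensity ::
    "'a measure \<Rightarrow> (real \<Rightarrow> 'a measure) \<Rightarrow> ('a \<Rightarrow> real set) \<Rightarrow> (real \<Rightarrow> 'a \<Rightarrow> real) \<Rightarrow> bool"
  where "has_intensity M F S L \<longleftrightarrow>
    (\<forall>t\<ge>0. \<forall>\<omega>\<in>space M. 0 \<le> L t \<omega>) \<and>
    progressively_measurable F L \<and>
    (\<forall>t\<ge>0. AE \<omega> in M. (\<integral>\<^sup>+s\<in>{0..t}. ennreal (L s \<omega>) \<partial>lborel) < \<infinity>) \<and>
    (\<forall>C :: real \<times> 'a \<Rightarrow> ennreal. C \<in> borel_measurable (predictable_algebra (space M) F) \<longrightarrow>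
      (\<integral>\<^sup>+\<omega>. (\<integral>\<^sup>+s. C (s, \<omega>) \<partial>count_space (S \<omega>)) \<partial>M) =
      (\<integral>\<^sup>+\<omega>. (\<integral>\<^sup>+s\<in>{0<..}. C (s, \<omega>) * ennreal (L s \<omega>) \<partial>lborel) \<partial>M))"

definition self_exciting_process ::
    "'a measure \<Rightarrow> (real \<Rightarrow> real) \<Rightarrow> real \<Rightarrow> ('a \<Rightarrow> real set) \<Rightarrow> bool"
  where "self_exciting_process M rate \<gamma> S \<longleftrightarrow>
    prob_space M \<and>
    simple_point_process M S \<and>
    has_intensity M (natural_filtration M S) S
      (\<lambda>t \<omega>. rate ((real (count_before S t \<omega>) + \<gamma>) / (t + 1)))"

text \<open>
  The rate is a function on \<open>[0, \<infinity>)\<close>, so its values at negative arguments are irrelevant and the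
  derivative at \<open>0\<close> is one-sided.
\<close>

definition admissible_rate :: "(real \<Rightarrow> real) \<Rightarrow> bool"
  where "admissible_rate rate \<longleftrightarrow>
    (\<forall>x\<ge>0. 0 \<le> rate x) \<and>
    mono_on {0..} rate \<and>
    finite {x. 0 \<le> x \<and> x = rate x} \<and>
    (\<exists>rate'. (\<forall>x\<ge>0. (rate has_real_derivative rate' x) (at x within {0..})) \<and>
      continuous_on {0..} rate' \<and>
      (\<forall>x\<ge>0. x = rate x \<longrightarrow> rate' x < 1 \<or> rate' x > 1))"

definition fixed_point :: "(real \<Rightarrow> real) \<Rightarrow> ereal"
  where "fixed_point rate =
    (if \<exists>x\<ge>0. x = rate x then ereal (THE x. 0 \<le> x \<and> x = rate x) else \<infinity>)"

text \<open>Convergence in probability as \<open>t \<rightarrow> \<infinity>\<close> of real random variables to a constant in \<open>[-\<infinity>, \<infinity>]\<close>.\<close>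

definition converges_in_prob :: "'a measure \<Rightarrow> (real \<Rightarrow> 'a \<Rightarrow> real) \<Rightarrow> ereal \<Rightarrow> bool"
  where "converges_in_prob M X l \<longleftrightarrow>
    (case l of
      ereal r \<Rightarrow> (\<forall>\<epsilon>>0. ((\<lambda>t. measure M {\<omega> \<in> space M. \<bar>X t \<omega> - r\<bar> > \<epsilon>}) \<longlongrightarrow> 0) at_top)
    | PInfty \<Rightarrow> (\<forall>K. ((\<lambda>t. measure M {\<omega> \<in> space M. X t \<omega> \<le> K}) \<longlongrightarrow> 0) at_top)
    | MInfty \<Rightarrow> (\<forall>K. ((\<lambda>t. measure M {\<omega> \<in> space M. X t \<omega> \<ge> K}) \<longlongrightarrow> 0) at_top))"

end

theory Submission
  imports Defs "HOL-Real_Asymp.Real_Asymp"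
begin

text \<open>
  Put \<open>Z\<^sub>t = N\<^sub>t + \<gamma> - x (t + 1)\<close> where \<open>x\<close> is the fixed point, which exists and is finite because the rate
  is a contraction. Since \<open>\<bar>\<lambda>\<^sub>t - x\<bar> \<le> \<alpha> \<bar>Z\<^bsub>t-\<^esub>\<bar> / (t + 1)\<close>, the drift of
  \<open>Z\<^sub>t\<^sup>2 * (t + 1) powr (- (1 + \<alpha>))\<close> is at most a constant times \<open>(t + 1) powr (- (1 + \<alpha>))\<close>, which
  is integrable over \<open>t \<ge> 0\<close>. Hence \<open>E (Z\<^sub>t / (t + 1))\<^sup>2 = O((t + 1) powr (\<alpha> - 1))\<close>, and convergence in probability
  is Chebyshev's inequality. Along \<open>t = n ^ k\<close> with \<open>k (1 - \<alpha>) \<ge> 2\<close> these bounds are summable,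
  which gives almost sure convergence, and monotonicity of \<open>N\<close> fills in the times between.
\<close>

subsection \<open>Integration along the points of a locally finite set\<close>

text \<open>The exponent 1 + \<alpha> of the weight meets three demands on an exponent e. In the
  drift of Z^2 the contraction leaves at most 2 \<alpha> Z^2 / (t + 1), plus the intensity itself,
  which stems from the squared unit jumps and grows at most linearly in |Z| / (t + 1).
  Differentiating the weight contributes - e Z^2 / (t + 1), so e > 2 \<alpha> absorbs both up to a
  constant; e > 1 makes the weight integrable; e < 2 leaves a decaying bound after division by (t +
  1)^2.

  The obstacle is that Z^2 cannot be put into the intensity identity: that identity speaks of
  nonnegative predictable integrands only, and no moment of N is known to be finite beforehand. The
  change of variables along a path is therefore written without subtraction, positive and negative
  parts on opposite sides, expectations are taken in the extended nonnegative reals, and the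
  negative parts are cancelled only once they are known to be finite. A cap on the count supplies
  this finiteness, and Fatou's lemma removes the cap.\<close>

lemma sum_card_less_eq:
  fixes A :: "'b::linorder set" and h :: "nat \<Rightarrow> 'c::comm_monoid_add"
  assumes "finite A"
  shows "(\<Sum>p\<in>A. h (card (A \<inter> {..<p}))) = (\<Sum>n<card A. h n)"
  using assms
proof (induction rule: finite_linorder_max_induct)
  case empty
  then show ?case by simp
next
  case (insert b A)
  \<comment> \<open>The new element is the maximum: it has all of \<open>A\<close> below it and
    leaves the counts of the old elements unchanged.\<close>
  have "insert b A \<inter> {..<b} = A"
    using insert.hyps by auto
  moreover have "(\<Sum>p\<in>A. h (card (insert b A \<inter> {..<p}))) = (\<Sum>p\<in>A. h (card (A \<inter> {..<p})))"
    by (rule sum.cong) (use insert.hyps in \<open>auto intro!: arg_cong[where f=h] arg_cong[where f=card]\<close>)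
  moreover have "b \<notin> A" using insert.hyps by auto
  ultimately show ?case
    using insert by (simp add: add.commute)
qed

text \<open>Between points the path moves by the time derivative \<open>a\<close>, at a point by the
  jump of \<open>G\<close>. Instead of cutting the interval at the points, \<open>a s (N s)\<close>
  is expanded as \<open>a s 0\<close> plus one increment for each point before \<open>s\<close>;
  each summand is then integrated by the fundamental theorem of calculus.\<close>

lemma jump_process_ftc:
  fixes P :: "real set" and G a :: "real \<Rightarrow> nat \<Rightarrow> real"
  defines "N \<equiv> \<lambda>s. card (P \<inter> {0<..<s})"
  assumes fin: "finite (P \<inter> {0<..T})" and T: "0 \<le> T"
    and deriv: "\<And>s n. s \<in> {0..T} \<Longrightarrow>
      ((\<lambda>s. G s n) has_real_derivative a s n) (at s within {0..T})"
  shows "((\<lambda>s. a s (N s)) has_integral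
    G T (card (P \<inter> {0<..T})) - G 0 0 -
      (\<Sum>p\<in>P \<inter> {0<..T}. G p (Suc (N p)) - G p (N p))) {0..T}"
proof -
  let ?A = "P \<inter> {0<..T}"
  \<comment> \<open>\<open>N\<close> counts strictly earlier points, so it runs through 0, 1, 2, ...
    on the points of an initial segment and the sum telescopes. \<open>UNIV\<close> serves the count
    at \<open>T\<close>, \<open>{..<s}\<close> the left limit at \<open>s\<close>.\<close>
  have tele: "(\<Sum>p\<in>P \<inter> {0<..T} \<inter> I. h (Suc (N p)) - h (N p)) = h (card (P \<inter> {0<..T} \<inter> I)) - h 0"
    if "I = UNIV \<or> (\<exists>s. I = {..<s})" for h :: "nat \<Rightarrow> real" and I
  proof -
    let ?B = "P \<inter> {0<..T} \<inter> I"
    have "(\<Sum>p\<in>?B. h (Suc (N p)) - h (N p)) =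
        (\<Sum>p\<in>?B. (\<lambda>n. h (Suc n) - h n) (card (?B \<inter> {..<p})))"
    proof (rule sum.cong[OF refl])
      fix p assume "p \<in> ?B"
      then have "P \<inter> {0<..<p} = ?B \<inter> {..<p}"
        using that by auto
      then show "h (Suc (N p)) - h (N p) =
          (\<lambda>n. h (Suc n) - h n) (card (?B \<inter> {..<p}))"
        by (simp add: N_def)
    qed
    also have "\<dots> = (\<Sum>n<card ?B. h (Suc n) - h n)"
      using fin by (intro sum_card_less_eq) auto
    also have "\<dots> = h (card ?B) - h 0"
      by (rule sum_lessThan_telescope)
    finally show ?thesis .
  qed
  have ftc: "((\<lambda>s. a s n) has_integral G T n - G p n) {p..T}" if "p \<in> {0..T}" for p n
  proof (rule fundamental_theorem_of_calculus)
    fix s assume "s \<in> {p..T}"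
    with that have "((\<lambda>s. G s n) has_real_derivative a s n) (at s within {p..T})"
      by (intro DERIV_subset[OF deriv]) auto
    then show "((\<lambda>s. G s n) has_vector_derivative a s n) (at s within {p..T})"
      by (simp add: has_real_derivative_iff_has_vector_derivative)
  qed (use that in auto)
  have jump: "((\<lambda>s. if p < s then a s (Suc (N p)) - a s (N p) else 0) has_integral
      (G T (Suc (N p)) - G T (N p)) - (G p (Suc (N p)) - G p (N p))) {0..T}" (is "(?f has_integral ?i) _")
    if p: "p \<in> ?A" for p
  proof -
    let ?g = "\<lambda>s. a s (Suc (N p)) - a s (N p)"
    have "(?g has_integral
        (G T (Suc (N p)) - G p (Suc (N p))) - (G T (N p) - G p (N p))) {p..T}"
      using p by (intro has_integral_diff ftc) auto
    then have "(?g has_integral ?i) {p..T}"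
      by (simp add: algebra_simps)
    moreover have "{p..T} \<subseteq> {0..T}" using p by auto
    ultimately have "((\<lambda>s. if s \<in> {p..T} then ?g s else 0) has_integral ?i) {0..T}"
      by (simp only: has_integral_restrict)
    \<comment> \<open>The strict \<open>p < s\<close> comes from the left limit; it differs from the
      closed interval only at \<open>p\<close>, which the integral does not see.\<close>
    then show ?thesis
      by (rule has_integral_spike_finite[where S="{p}", rotated 2]) (use p in auto)
  qed
  have "((\<lambda>s. a s 0 + (\<Sum>p\<in>?A. if p < s then a s (Suc (N p)) - a s (N p) else 0)) has_integral
     (G T 0 - G 0 0) + (\<Sum>p\<in>?A. (G T (Suc (N p)) - G T (N p)) - (G p (Suc (N p)) - G p (N p)))) {0..T}"
    using fin T by (intro has_integral_add has_integral_sum ftc jump) auto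
  also have "(G T 0 - G 0 0) + (\<Sum>p\<in>?A. (G T (Suc (N p)) - G T (N p)) - (G p (Suc (N p)) - G p (N p)))
     = G T (card (P \<inter> {0<..T})) - G 0 0 - (\<Sum>p\<in>?A. G p (Suc (N p)) - G p (N p))"
    using tele[of UNIV "G T"] by (simp add: sum_subtractf)
  finally show ?thesis
  proof (rule has_integral_cong[THEN iffD1, rotated])
    fix s assume s: "s \<in> {0..T}"
    have "(\<Sum>p\<in>?A. if p < s then a s (Suc (N p)) - a s (N p) else 0)
        = (\<Sum>p\<in>?A \<inter> {..<s}. a s (Suc (N p)) - a s (N p))"
      using fin by (subst sum.inter_restrict) auto
    also have "\<dots> = a s (card (?A \<inter> {..<s})) - a s 0"
      by (rule tele) auto
    also have "?A \<inter> {..<s} = P \<inter> {0<..<s}"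
      using s by auto
    finally show "a s 0 + (\<Sum>p\<in>?A. if p < s then a s (Suc (N p)) - a s (N p) else 0) = a s (N s)"
      by (simp add: N_def)
  qed
qed

subsection \<open>Predictability of the left limit\<close>

text \<open>A rational strictly between the last point before \<open>s\<close> and \<open>s\<close>
  already sees every point before \<open>s\<close>. This turns a statement about the left limit into
  a countable union of conditions on \<open>N\<close> at fixed times.\<close>

lemma less_count_before_iff:
  assumes "simple_point_process M S" "\<omega> \<in> space M"
  shows "n < count_before S s \<omega> \<longleftrightarrow> (\<exists>q\<in>{q\<in>\<rat>. 0 \<le> q}. q < s \<and> n < count_upto S q \<omega>)"
proof
  have fin: "finite (S \<omega> \<inter> {0<..t})" for t
    using assms by (auto simp: simple_point_process_def)
  have fin': "finite (S \<omega> \<inter> {0<..<s})"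
    by (rule finite_subset[OF _ fin[of s]]) auto
  {
    assume n: "n < count_before S s \<omega>"
    then have ne: "S \<omega> \<inter> {0<..<s} \<noteq> {}"
      by (auto simp: count_before_def)
    define m where "m = Max (S \<omega> \<inter> {0<..<s})"
    have "m \<in> S \<omega> \<inter> {0<..<s}"
      unfolding m_def using fin' ne by (rule Max_in)
    then have m: "0 < m" "m < s" by auto
    obtain q where q: "q \<in> \<rat>" "m < q" "q < s"
      using Rats_dense_in_real[OF m(2)] by auto
    have "count_before S s \<omega> \<le> count_upto S q \<omega>"
      unfolding count_before_def count_upto_def
    proof (rule card_mono[OF fin], safe)
      fix p assume "p \<in> S \<omega>" "p \<in> {0<..<s}"
      then have "p \<le> m" unfolding m_def using fin' by auto
      with \<open>p \<in> {0<..<s}\<close> q show "p \<in> {0<..q}" by auto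
    qed
    with n q m show "\<exists>q\<in>{q\<in>\<rat>. 0 \<le> q}. q < s \<and> n < count_upto S q \<omega>"
      by (intro bexI[of _ q]) auto
  }
  {
    assume "\<exists>q\<in>{q\<in>\<rat>. 0 \<le> q}. q < s \<and> n < count_upto S q \<omega>"
    then obtain q where q: "q < s" "n < count_upto S q \<omega>" by auto
    moreover have "count_upto S q \<omega> \<le> count_before S s \<omega>"
      unfolding count_before_def count_upto_def
      using q by (intro card_mono[OF fin']) auto
    ultimately show "n < count_before S s \<omega>" by simp
  }
qed

text \<open>The sigma-algebra \<open>X\<close> on pairs of time and outcome is left open because two
  instances are needed: the predictable one, to apply the intensity identity, and the product one,
  to integrate over time and then over outcomes.\<close>

lemma measurable_count_before:
  assumes S: "simple_point_process M S"
    and X: "\<And>s \<omega>. (s, \<omega>) \<in> space X \<Longrightarrow> \<omega> \<in> space M"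
    and gen: "\<And>q n. 0 \<le> q \<Longrightarrow> {(s, \<omega>) \<in> space X. q < s \<and> n < count_upto S q \<omega>} \<in> sets X"
  shows "(\<lambda>(s, \<omega>). count_before S s \<omega>) \<in> measurable X (count_space UNIV)"
proof -
  let ?N = "\<lambda>(s, \<omega>). count_before S s \<omega>"
  have gt: "{x \<in> space X. n < ?N x} \<in> sets X" for n
  proof -
    have "{x \<in> space X. n < ?N x} =
        (\<Union>q\<in>{q\<in>\<rat>. 0 \<le> q}. {(s, \<omega>) \<in> space X. q < s \<and> n < count_upto S q \<omega>})"
      using less_count_before_iff[OF S] X by (auto 0 3)
    also have "\<dots> \<in> sets X"
      using gen by (intro sets.countable_UN'') (auto intro: countable_subset[OF _ countable_rat])
    finally show ?thesis .
  qed
  have "?N -` {n} \<inter> space X \<in> sets X" for n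
  proof (cases n)
    case 0
    then have "?N -` {n} \<inter> space X = space X - {x \<in> space X. 0 < ?N x}" by auto
    then show ?thesis using gt by auto
  next
    case (Suc m)
    then have "?N -` {n} \<inter> space X = {x \<in> space X. m < ?N x} - {x \<in> space X. n < ?N x}" by auto
    then show ?thesis using gt by auto
  qed
  then show ?thesis
    by (subst measurable_count_space_eq2_countable) auto
qed

lemma measurable_count_before_pair:
  assumes S: "simple_point_process M S"
  shows "(\<lambda>(s, \<omega>). count_before S s \<omega>) \<in> measurable (borel \<Otimes>\<^sub>M M) (count_space UNIV)"
proof (rule measurable_count_before[OF S])
  fix q :: real and n
  have [measurable]: "count_upto S q \<in> measurable M (count_space UNIV)"
    using S by (simp add: simple_point_process_def)
  have "{x \<in> space (borel \<Otimes>\<^sub>M M). q < fst x \<and> n < count_upto S q (snd x)} \<in> sets (borel \<Otimes>\<^sub>M M)"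
    by measurable
  then show "{(s, \<omega>) \<in> space (borel \<Otimes>\<^sub>M M). q < s \<and> n < count_upto S q \<omega>} \<in> sets (borel \<Otimes>\<^sub>M M)"
    by (simp add: case_prod_unfold)
qed (auto simp: space_pair_measure)

lemma space_predictable_algebra:
  assumes "\<And>a. space (F a) = \<Omega>"
  shows "space (predictable_algebra \<Omega> F) = {0<..} \<times> \<Omega>"
  and sets_predictable_algebra: "sets (predictable_algebra \<Omega> F) =
    sigma_sets ({0<..} \<times> \<Omega>) {{a<..b} \<times> A | a b A. 0 \<le> a \<and> a \<le> b \<and> A \<in> sets (F a)}"
proof -
  have "{{a<..b} \<times> A | a b A. 0 \<le> a \<and> a \<le> b \<and> A \<in> sets (F a)} \<subseteq> Pow ({0<..} \<times> \<Omega>)"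
  proof safe
    fix a b :: real and A s \<omega> assume "A \<in> sets (F a)" "\<omega> \<in> A"
    then show "\<omega> \<in> \<Omega>"
      using sets.sets_into_space assms by blast
  qed auto
  then show "space (predictable_algebra \<Omega> F) = {0<..} \<times> \<Omega>"
    "sets (predictable_algebra \<Omega> F) =
      sigma_sets ({0<..} \<times> \<Omega>) {{a<..b} \<times> A | a b A. 0 \<le> a \<and> a \<le> b \<and> A \<in> sets (F a)}"
    by (simp_all add: predictable_algebra_def space_measure_of_conv)
qed

lemma predictable_left_open_ray:
  assumes F: "\<And>a. space (F a) = \<Omega>" and "0 \<le> q" "A \<in> sets (F q)"
  shows "{q<..} \<times> A \<in> sets (predictable_algebra \<Omega> F)"
proof -
  have "{q<..} \<times> A = (\<Union>m. {q<..q + real m} \<times> A)"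
  proof safe
    fix s \<omega> assume "q < s" "\<omega> \<in> A"
    obtain m where "s - q \<le> real m" using real_arch_simple by blast
    with \<open>q < s\<close> \<open>\<omega> \<in> A\<close> show "(s, \<omega>) \<in> (\<Union>m. {q<..q + real m} \<times> A)"
      by (intro UN_I[of m]) auto
  qed auto
  also have "\<dots> \<in> sets (predictable_algebra \<Omega> F)"
  proof (intro sets.countable_UN, safe)
    fix m
    show "{q<..q + real m} \<times> A \<in> sets (predictable_algebra \<Omega> F)"
      unfolding sets_predictable_algebra[of F, OF F]
      using assms(2,3) by (intro sigma_sets.Basic CollectI exI[of _ q] exI[of _ "q + real m"] exI[of _ A]) auto
  qed
  finally show ?thesis .
qed

lemma measurable_fst_predictable:
  assumes F: "\<And>a. space (F a) = \<Omega>"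
  shows "fst \<in> borel_measurable (predictable_algebra \<Omega> F)"
proof (rule borel_measurableI_greater)
  fix y :: real
  have "fst -` {y<..} \<inter> space (predictable_algebra \<Omega> F) = {max 0 y<..} \<times> \<Omega>"
    by (auto simp: space_predictable_algebra[of F, OF F])
  moreover have "\<Omega> \<in> sets (F (max 0 y))"
    using F[of "max 0 y"] by blast
  ultimately show "{x \<in> space (predictable_algebra \<Omega> F). y < fst x} \<in> sets (predictable_algebra \<Omega> F)"
    using predictable_left_open_ray[of F, OF F, of "max 0 y" \<Omega>]
    by (simp add: vimage_def Int_def conj_commute)
qed

lemma space_natural_filtration: "space (natural_filtration M S t) = space M"
  by (simp add: natural_filtration_def space_measure_of_conv)

lemma measurable_count_before_predictable:
  assumes S: "simple_point_process M S"
  shows "(\<lambda>(s, \<omega>). count_before S s \<omega>) \<in>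
    measurable (predictable_algebra (space M) (natural_filtration M S)) (count_space UNIV)"
proof (rule measurable_count_before[OF S])
  note sp = space_predictable_algebra[of "natural_filtration M S", OF space_natural_filtration]
  show "\<omega> \<in> space M"
    if "(s, \<omega>) \<in> space (predictable_algebra (space M) (natural_filtration M S))" for s \<omega>
    using that by (simp add: sp)
  fix q :: real and n
  assume q: "0 \<le> q"
  have "count_upto S q -` {n<..} \<inter> space M \<in> sets (natural_filtration M S q)"
    unfolding natural_filtration_def using q by (intro in_measure_of) auto
  from predictable_left_open_ray[of "natural_filtration M S", OF space_natural_filtration q this]
  have "{q<..} \<times> (count_upto S q -` {n<..} \<inter> space M) \<in>
    sets (predictable_algebra (space M) (natural_filtration M S))" .
  also have "{q<..} \<times> (count_upto S q -` {n<..} \<inter> space M) =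
    {(s, \<omega>) \<in> space (predictable_algebra (space M) (natural_filtration M S)).
      q < s \<and> n < count_upto S q \<omega>}"
    using q by (auto simp: sp)
  finally show "{(s, \<omega>) \<in> space (predictable_algebra (space M) (natural_filtration M S)).
      q < s \<and> n < count_upto S q \<omega>} \<in> sets (predictable_algebra (space M) (natural_filtration M S))" .
qed

subsection \<open>A Dynkin inequality\<close>

text \<open>Passage from a signed identity to one without subtraction: the negative part of
  \<open>f\<close> moves to the other side. In this form expectations can be taken with no
  integrability over outcomes.\<close>

lemma ennreal_integral_balance:
  fixes f :: "'b \<Rightarrow> real"
  assumes "integrable X f" "g + x = h + y + integral\<^sup>L X f"
    "0 \<le> g" "0 \<le> h" "0 \<le> x" "0 \<le> y"
  shows "ennreal g + (\<integral>\<^sup>+s. ennreal (- f s) \<partial>X) + ennreal x =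
    ennreal h + (\<integral>\<^sup>+s. ennreal (f s) \<partial>X) + ennreal y"
proof -
  have fin: "(\<integral>\<^sup>+s. ennreal (f s) \<partial>X) \<noteq> \<infinity>" "(\<integral>\<^sup>+s. ennreal (- f s) \<partial>X) \<noteq> \<infinity>"
    using assms(1) by (auto simp: real_integrable_def)
  obtain p where p: "0 \<le> p" "(\<integral>\<^sup>+s. ennreal (f s) \<partial>X) = ennreal p"
    using fin by (cases "\<integral>\<^sup>+s. ennreal (f s) \<partial>X") auto
  obtain q where q: "0 \<le> q" "(\<integral>\<^sup>+s. ennreal (- f s) \<partial>X) = ennreal q"
    using fin by (cases "\<integral>\<^sup>+s. ennreal (- f s) \<partial>X") auto
  have "integral\<^sup>L X f = p - q"
    using p q by (subst real_lebesgue_integral_def[OF assms(1)]) simp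
  then have "g + q + x = h + p + y"
    using assms(2) by simp
  then show ?thesis
    using assms(3-) p q by (simp flip: ennreal_plus)
qed

text \<open>The pathwise change of variables with all terms nonnegative. The jumps appear as
  integrals over \<open>count_space P\<close>, which is how the intensity identity expresses
  integration along the points.\<close>

lemma jump_process_balance:
  fixes P :: "real set" and G a :: "real \<Rightarrow> nat \<Rightarrow> real"
  defines "N \<equiv> \<lambda>s. card (P \<inter> {0<..<s})"
  assumes fin: "finite (P \<inter> {0<..T})" and P: "P \<subseteq> {0<..}" and T: "0 \<le> T"
    and deriv: "\<And>s n. s \<in> {0..T} \<Longrightarrow>
      ((\<lambda>s. G s n) has_real_derivative a s n) (at s within {0..T})"
    and bounded: "\<And>s n. s \<in> {0..T} \<Longrightarrow> \<bar>a s n\<bar> \<le> A"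
    and [measurable]: "(\<lambda>s. a s (N s)) \<in> borel_measurable borel"
    and G: "\<And>s n. 0 \<le> G s n"
  shows "ennreal (G T (card (P \<inter> {0<..T})))
      + (\<integral>\<^sup>+s. ennreal (- a s (N s)) * indicator {0<..T} s \<partial>lborel)
      + (\<integral>\<^sup>+s. ennreal (- (G s (Suc (N s)) - G s (N s))) * indicator {0<..T} s \<partial>count_space P)
    = ennreal (G 0 0) + (\<integral>\<^sup>+s. ennreal (a s (N s)) * indicator {0<..T} s \<partial>lborel)
      + (\<integral>\<^sup>+s. ennreal (G s (Suc (N s)) - G s (N s)) * indicator {0<..T} s \<partial>count_space P)"
proof -
  let ?d = "\<lambda>s. G s (Suc (N s)) - G s (N s)"
  let ?f = "\<lambda>s. a s (N s) * indicator {0<..T} s"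
  have count: "(\<integral>\<^sup>+s. ennreal (h s) * indicator {0<..T} s \<partial>count_space P) =
      ennreal (\<Sum>p\<in>P \<inter> {0<..T}. max 0 (h p))" for h
  proof -
    have "(\<integral>\<^sup>+s. ennreal (h s) * indicator {0<..T} s \<partial>count_space P) =
        (\<Sum>p\<in>P \<inter> {0<..T}. ennreal (h p) * indicator {0<..T} p)"
      using fin by (intro nn_integral_count_space') auto
    also have "\<dots> = (\<Sum>p\<in>P \<inter> {0<..T}. ennreal (max 0 (h p)))"
      by (intro sum.cong) (auto simp: max_def ennreal_neg)
    also have "\<dots> = ennreal (\<Sum>p\<in>P \<inter> {0<..T}. max 0 (h p))"
      by (rule sum_ennreal) simp
    finally show ?thesis .
  qed
  have "0 \<le> A" using bounded[of 0 0] T by auto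
  then have int: "integrable lborel (\<lambda>s. indicator {0..T} s *\<^sub>R a s (N s))"
    using bounded T by (intro integrableI_bounded_set_indicator[where B=A]) auto
  have int': "integrable lborel ?f"
    by (rule Bochner_Integration.integrable_bound[OF int]) (auto simp: indicator_def)
  \<comment> \<open>The fundamental theorem works on the closed interval, the predictable setting on
    the one open at 0; they differ by a null set.\<close>
  have "integral\<^sup>L lborel ?f = (LINT s:{0..T}|lborel. a s (N s))"
    unfolding set_lebesgue_integral_def
    by (intro integral_cong_AE AE_I[where N="{0}"]) (auto simp: indicator_def)
  also have "\<dots> = integral {0..T} (\<lambda>s. a s (N s))"
    using int by (intro set_borel_integral_eq_integral(2)) (simp add: set_integrable_def)
  also have "\<dots> = G T (card (P \<inter> {0<..T})) - G 0 0 - (\<Sum>p\<in>P \<inter> {0<..T}. ?d p)"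
    unfolding N_def by (intro integral_unique jump_process_ftc fin T deriv)
  also have "(\<Sum>p\<in>P \<inter> {0<..T}. ?d p) =
      (\<Sum>p\<in>P \<inter> {0<..T}. max 0 (?d p)) - (\<Sum>p\<in>P \<inter> {0<..T}. max 0 (- ?d p))"
    unfolding sum_subtractf[symmetric] by (intro sum.cong) auto
  finally have "ennreal (G T (card (P \<inter> {0<..T})))
      + (\<integral>\<^sup>+s. ennreal (- ?f s) \<partial>lborel) + ennreal (\<Sum>p\<in>P \<inter> {0<..T}. max 0 (- ?d p))
    = ennreal (G 0 0) + (\<integral>\<^sup>+s. ennreal (?f s) \<partial>lborel) + ennreal (\<Sum>p\<in>P \<inter> {0<..T}. max 0 (?d p))"
    using int' G by (intro ennreal_integral_balance sum_nonneg) auto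
  moreover have "ennreal (?f s) = ennreal (a s (N s)) * indicator {0<..T} s"
    "ennreal (- ?f s) = ennreal (- a s (N s)) * indicator {0<..T} s" for s
    by (auto simp: indicator_def)
  ultimately show ?thesis
    by (simp only: count)
qed

text \<open>
  The sum of a predictable process over the points need not be known to be measurable in \<open>\<omega>\<close>, so additivity
  is needed with only one measurable summand; finiteness of that summand makes this possible.
\<close>

lemma nn_integral_add_measurable_left:
  fixes m f :: "'b \<Rightarrow> ennreal"
  assumes [measurable]: "m \<in> borel_measurable X" and fin: "\<And>x. x \<in> space X \<Longrightarrow> m x < \<infinity>"
  shows "(\<integral>\<^sup>+x. m x + f x \<partial>X) = (\<integral>\<^sup>+x. m x \<partial>X) + (\<integral>\<^sup>+x. f x \<partial>X)"
proof (rule antisym)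
  show "(\<integral>\<^sup>+x. m x + f x \<partial>X) \<le> (\<integral>\<^sup>+x. m x \<partial>X) + (\<integral>\<^sup>+x. f x \<partial>X)"
    unfolding nn_integral_def[of X "\<lambda>x. m x + f x"]
  proof (rule SUP_least, safe)
    fix s assume s: "simple_function X s" "s \<le> (\<lambda>x. m x + f x)"
    have [measurable]: "s \<in> borel_measurable X"
      using s(1) by (rule borel_measurable_simple_function)
    have "integral\<^sup>S X s = (\<integral>\<^sup>+x. s x \<partial>X)"
      using s(1) by (simp add: nn_integral_eq_simple_integral)
    \<comment> \<open>The truncated difference \<open>s x - m x\<close> is measurable, so ordinary
      additivity applies to it. It stays below \<open>f\<close> because \<open>m\<close> is finite,
      and thus it enters the supremum that defines the integral of \<open>f\<close>.\<close>
    also have "\<dots> \<le> (\<integral>\<^sup>+x. m x + (s x - m x) \<partial>X)"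
      by (intro nn_integral_mono) (metis add.commute ennreal_minus_le_iff order_refl)
    also have "\<dots> = (\<integral>\<^sup>+x. m x \<partial>X) + (\<integral>\<^sup>+x. s x - m x \<partial>X)"
      by (intro nn_integral_add) auto
    also have "\<dots> \<le> (\<integral>\<^sup>+x. m x \<partial>X) + (\<integral>\<^sup>+x. f x \<partial>X)"
    proof (intro add_left_mono nn_integral_mono)
      fix x assume "x \<in> space X"
      then show "s x - m x \<le> f x"
        using s(2) fin[of x] by (auto simp: ennreal_minus_le_iff le_fun_def)
    qed
    finally show "integral\<^sup>S X s \<le> (\<integral>\<^sup>+x. m x \<partial>X) + (\<integral>\<^sup>+x. f x \<partial>X)" .
  qed
  have "(\<integral>\<^sup>+x. f x \<partial>X) + (\<integral>\<^sup>+x. m x \<partial>X) =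
      (SUP s\<in>{s. simple_function X s \<and> s \<le> f}. integral\<^sup>S X s + (\<integral>\<^sup>+x. m x \<partial>X))"
    unfolding nn_integral_def[of X f]
    by (rule ennreal_SUP_add_left[symmetric]) (auto intro!: exI[of _ "\<lambda>_. 0"] simp: le_fun_def)
  also have "\<dots> \<le> (\<integral>\<^sup>+x. m x + f x \<partial>X)"
  proof (rule SUP_least, safe)
    fix s assume s: "simple_function X s" "s \<le> f"
    then have "integral\<^sup>S X s + (\<integral>\<^sup>+x. m x \<partial>X) = (\<integral>\<^sup>+x. s x + m x \<partial>X)"
      by (subst nn_integral_add) (auto simp: nn_integral_eq_simple_integral intro: borel_measurable_simple_function)
    also have "\<dots> \<le> (\<integral>\<^sup>+x. m x + f x \<partial>X)"
      using s(2) by (intro nn_integral_mono) (auto simp: le_fun_def add.commute intro: add_left_mono)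
    finally show "integral\<^sup>S X s + (\<integral>\<^sup>+x. m x \<partial>X) \<le> (\<integral>\<^sup>+x. m x + f x \<partial>X)" .
  qed
  finally show "(\<integral>\<^sup>+x. m x \<partial>X) + (\<integral>\<^sup>+x. f x \<partial>X) \<le> (\<integral>\<^sup>+x. m x + f x \<partial>X)"
    by (simp add: add.commute)
qed

text \<open>\<open>a + L * (jump of G)\<close> is the generator applied to \<open>G\<close>, so the
  expectation of \<open>G\<close> grows at most by the integral of its bound \<open>c\<close>. The
  bounds on \<open>a\<close> and on the jumps serve to make the negative parts finite, hence
  cancellable; that only counts below \<open>K\<close> produce a jump is what bounds the total of
  the jumps.\<close>

lemma dynkin_inequality:
  fixes M :: "'a measure" and S :: "'a \<Rightarrow> real set" and G a L :: "real \<Rightarrow> nat \<Rightarrow> real"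
  defines "N \<equiv> count_before S"
  assumes M: "prob_space M" and S: "simple_point_process M S" and T: "0 \<le> T"
    and compensator: "\<And>C :: real \<times> 'a \<Rightarrow> ennreal.
      C \<in> borel_measurable (predictable_algebra (space M) (natural_filtration M S)) \<Longrightarrow>
      (\<integral>\<^sup>+\<omega>. (\<integral>\<^sup>+s. C (s, \<omega>) \<partial>count_space (S \<omega>)) \<partial>M) =
      (\<integral>\<^sup>+\<omega>. (\<integral>\<^sup>+s\<in>{0<..}. C (s, \<omega>) * ennreal (L s (N s \<omega>)) \<partial>lborel) \<partial>M)"
    and deriv: "\<And>s n. s \<in> {0..T} \<Longrightarrow>
      ((\<lambda>s. G s n) has_real_derivative a s n) (at s within {0..T})"
    and meas[measurable]: "\<And>n. (\<lambda>s. L s n) \<in> borel_measurable borel"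
      "\<And>n. (\<lambda>s. a s n) \<in> borel_measurable borel" "\<And>n. (\<lambda>s. G s n) \<in> borel_measurable borel"
      "c \<in> borel_measurable borel"
    and nonneg: "\<And>s n. 0 \<le> G s n" "\<And>s n. s \<in> {0<..T} \<Longrightarrow> 0 \<le> L s n" "\<And>s. s \<in> {0<..T} \<Longrightarrow> 0 \<le> c s"
    and bound_a: "\<And>s n. s \<in> {0..T} \<Longrightarrow> \<bar>a s n\<bar> \<le> A"
    and bound_d: "\<And>s n. s \<in> {0<..T} \<Longrightarrow> \<bar>G s (Suc n) - G s n\<bar> \<le> (if n < K then D else 0)"
    and drift: "\<And>s n. s \<in> {0<..T} \<Longrightarrow> a s n + L s n * (G s (Suc n) - G s n) \<le> c s"
  shows "(\<integral>\<^sup>+\<omega>. ennreal (G T (count_upto S T \<omega>)) \<partial>M) \<le>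
    ennreal (G 0 0) + (\<integral>\<^sup>+s\<in>{0<..T}. ennreal (c s) \<partial>lborel)"
proof -
  interpret prob_space M by fact
  interpret pair_sigma_finite lborel M ..
  let ?P = "predictable_algebra (space M) (natural_filtration M S)"
  let ?B = "borel \<Otimes>\<^sub>M M"
  define d where "d s n = G s (Suc n) - G s n" for s n
  have [measurable]: "(\<lambda>s. d s n) \<in> borel_measurable borel" for n
    unfolding d_def by measurable
  have subset: "S \<omega> \<subseteq> {0<..}" and finite: "finite (S \<omega> \<inter> {0<..t})" if "\<omega> \<in> space M" for \<omega> t
    using S that by (auto simp: simple_point_process_def)
  have [measurable]: "count_upto S t \<in> measurable M (count_space UNIV)" for t
    using S by (simp add: simple_point_process_def)
  have [measurable]: "fst \<in> borel_measurable ?P"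
    by (intro measurable_fst_predictable space_natural_filtration)
  have [measurable]: "(\<lambda>x. N (fst x) (snd x)) \<in> measurable ?P (count_space UNIV)"
    using measurable_count_before_predictable[OF S] by (simp add: N_def case_prod_unfold)
  have [measurable]: "(\<lambda>x. N (fst x) (snd x)) \<in> measurable ?B (count_space UNIV)"
    using measurable_count_before_pair[OF S] by (simp add: N_def case_prod_unfold)
  have measP: "(\<lambda>x. h (fst x) (N (fst x) (snd x))) \<in> borel_measurable ?P"
    if [measurable]: "\<And>n. (\<lambda>s. h s n) \<in> borel_measurable borel" for h :: "real \<Rightarrow> nat \<Rightarrow> ennreal"
    by (rule measurable_compose_countable[where f="\<lambda>n x. h (fst x) n"]) measurable
  have measB: "(\<lambda>x. h (fst x) (N (fst x) (snd x))) \<in> borel_measurable ?B"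
    if [measurable]: "\<And>n. (\<lambda>s. h s n) \<in> borel_measurable borel" for h :: "real \<Rightarrow> nat \<Rightarrow> ennreal"
    by (rule measurable_compose_countable[where f="\<lambda>n x. h (fst x) n"]) measurable
  have swap: "(\<lambda>x. h (snd x) (N (snd x) (fst x))) \<in> borel_measurable (M \<Otimes>\<^sub>M lborel)"
    if "\<And>n. (\<lambda>s. h s n) \<in> borel_measurable borel" for h :: "real \<Rightarrow> nat \<Rightarrow> ennreal"
  proof -
    have "(\<lambda>x. (snd x, fst x)) \<in> measurable (M \<Otimes>\<^sub>M lborel) ?B" by measurable
    from measurable_compose[OF this measB[of h, OF that]] show ?thesis by simp
  qed
  have sect: "(\<lambda>s. h s (N s \<omega>)) \<in> borel_measurable lborel"
    if "\<And>n. (\<lambda>s. h s n) \<in> borel_measurable borel" "\<omega> \<in> space M" for h :: "real \<Rightarrow> nat \<Rightarrow> ennreal" and \<omega>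
  proof -
    have "(\<lambda>s. (\<omega>, s)) \<in> measurable lborel (M \<Otimes>\<^sub>M lborel)" using that(2) by measurable
    from measurable_compose[OF this swap[of h, OF that(1)]] show ?thesis by simp
  qed
  have int: "(\<lambda>\<omega>. \<integral>\<^sup>+s. h s (N s \<omega>) \<partial>lborel) \<in> borel_measurable M"
    if "\<And>n. (\<lambda>s. h s n) \<in> borel_measurable borel" for h :: "real \<Rightarrow> nat \<Rightarrow> ennreal"
    using swap[of h, OF that]
    by (intro lborel.borel_measurable_nn_integral) (simp add: case_prod_unfold)
  \<comment> \<open>As \<open>ennreal\<close> sends negative reals to 0, \<open>I h\<close> and
    \<open>J h\<close> see only the positive part of \<open>h\<close>; the negative part is reached
    through \<open>- h\<close>. \<open>J\<close> is the expected sum over the points, already in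
    compensated form.\<close>
  define I where "I h = (\<integral>\<^sup>+\<omega>. (\<integral>\<^sup>+s. ennreal (h s (N s \<omega>)) * indicator {0<..T} s \<partial>lborel) \<partial>M)"
    for h :: "real \<Rightarrow> nat \<Rightarrow> real"
  define J where "J h = (\<integral>\<^sup>+\<omega>. (\<integral>\<^sup>+s. ennreal (h s (N s \<omega>)) * ennreal (L s (N s \<omega>)) * indicator {0<..T} s \<partial>lborel) \<partial>M)"
    for h :: "real \<Rightarrow> nat \<Rightarrow> real"
  have J: "(\<integral>\<^sup>+\<omega>. (\<integral>\<^sup>+s. ennreal (h s (N s \<omega>)) * indicator {0<..T} s \<partial>count_space (S \<omega>)) \<partial>M) = J h"
    if [measurable]: "\<And>n. (\<lambda>s. h s n) \<in> borel_measurable borel" for h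
  proof -
    have "(\<lambda>x. ennreal (h (fst x) (N (fst x) (snd x))) * indicator {0<..T} (fst x)) \<in> borel_measurable ?P"
      using measP[of "\<lambda>s n. ennreal (h s n) * indicator {0<..T} s"] by simp
    from compensator[OF this] show ?thesis
      unfolding J_def
      by (auto intro!: nn_integral_cong simp: indicator_def)
  qed

  let ?g = "\<lambda>\<omega>. ennreal (G T (count_upto S T \<omega>))"
  let ?A = "\<lambda>\<omega>. \<integral>\<^sup>+s. ennreal (a s (N s \<omega>)) * indicator {0<..T} s \<partial>lborel"
  let ?A' = "\<lambda>\<omega>. \<integral>\<^sup>+s. ennreal (- a s (N s \<omega>)) * indicator {0<..T} s \<partial>lborel"
  let ?D = "\<lambda>\<omega>. \<integral>\<^sup>+s. ennreal (d s (N s \<omega>)) * indicator {0<..T} s \<partial>count_space (S \<omega>)"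
  let ?D' = "\<lambda>\<omega>. \<integral>\<^sup>+s. ennreal (- d s (N s \<omega>)) * indicator {0<..T} s \<partial>count_space (S \<omega>)"
  have path: "?g \<omega> + ?A' \<omega> + ?D' \<omega> = ennreal (G 0 0) + ?A \<omega> + ?D \<omega>" if "\<omega> \<in> space M" for \<omega>
  proof -
    have "(\<lambda>s. \<omega>) \<in> measurable borel M" using that by simp
    then have "(\<lambda>s. (s, \<omega>)) \<in> measurable borel ?B" by measurable
    from measurable_compose[OF this, of "\<lambda>x. N (fst x) (snd x)"]
    have [measurable]: "(\<lambda>s. N s \<omega>) \<in> measurable borel (count_space UNIV)" by simp
    have "(\<lambda>s. a s (N s \<omega>)) \<in> borel_measurable borel"
      by (rule measurable_compose_countable[where f="\<lambda>n s. a s n"]) measurable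
    from jump_process_balance[OF finite[OF that] subset[OF that] T deriv bound_a, folded count_before_def,
        folded N_def, OF _ _ this nonneg(1)]
    show ?thesis
      by (simp add: d_def count_upto_def)
  qed
  have bound_A: "?A \<omega> \<le> ennreal (A * T)" "?A' \<omega> \<le> ennreal (A * T)" for \<omega>
  proof -
    have "0 \<le> A" using bound_a[of 0 0] T by auto
    then have AT: "(\<integral>\<^sup>+s. ennreal A * indicator {0<..T} s \<partial>lborel) = ennreal (A * T)"
      using T by (simp add: nn_integral_cmult_indicator ennreal_mult)
    have "ennreal (a s (N s \<omega>)) * indicator {0<..T} s \<le> ennreal A * indicator {0<..T} s"
      "ennreal (- a s (N s \<omega>)) * indicator {0<..T} s \<le> ennreal A * indicator {0<..T} s" for s
      using bound_a[of s "N s \<omega>"] by (auto simp: indicator_def intro!: ennreal_leI)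
    then show "?A \<omega> \<le> ennreal (A * T)" "?A' \<omega> \<le> ennreal (A * T)"
      unfolding AT[symmetric] by (intro nn_integral_mono; simp)+
  qed
  have measA: "?A \<in> borel_measurable M" "?A' \<in> borel_measurable M"
    using int[of "\<lambda>s n. ennreal (a s n) * indicator {0<..T} s"]
      int[of "\<lambda>s n. ennreal (- a s n) * indicator {0<..T} s"] by simp_all
  note [measurable] = measA
  have finA: "?A \<omega> < \<infinity>" "?A' \<omega> < \<infinity>" for \<omega>
    using bound_A[of \<omega>] by (auto intro: le_less_trans)

  \<comment> \<open>Expectation of the path identity. On each side the sum over the points is the
    summand of unknown measurability, and the others are measurable and finite, as the additivity
    lemma above requires.\<close>
  have "integral\<^sup>N M ?g + (I (\<lambda>s n. - a s n) + J (\<lambda>s n. - d s n)) =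
      (\<integral>\<^sup>+\<omega>. ?g \<omega> + ?A' \<omega> \<partial>M) + integral\<^sup>N M ?D'"
    unfolding I_def
    by (subst nn_integral_add) (auto simp: J[of "\<lambda>s n. - d s n", simplified] add.assoc)
  also have "\<dots> = (\<integral>\<^sup>+\<omega>. ?g \<omega> + ?A' \<omega> + ?D' \<omega> \<partial>M)"
    using finA by (intro nn_integral_add_measurable_left[symmetric]) auto
  also have "\<dots> = (\<integral>\<^sup>+\<omega>. ennreal (G 0 0) + ?A \<omega> + ?D \<omega> \<partial>M)"
    by (intro nn_integral_cong path)
  also have "\<dots> = (\<integral>\<^sup>+\<omega>. ennreal (G 0 0) + ?A \<omega> \<partial>M) + integral\<^sup>N M ?D"
    using finA by (intro nn_integral_add_measurable_left) auto
  also have "\<dots> = ennreal (G 0 0) + (I a + J d)"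
    unfolding I_def
    by (subst nn_integral_add) (auto simp: J add.assoc emeasure_space_1)
  finally have balance: "integral\<^sup>N M ?g + (I (\<lambda>s n. - a s n) + J (\<lambda>s n. - d s n)) =
      ennreal (G 0 0) + (I a + J d)" .

  have IJ: "I f + J h = (\<integral>\<^sup>+\<omega>. \<integral>\<^sup>+s. (ennreal (f s (N s \<omega>)) + ennreal (h s (N s \<omega>)) * ennreal (L s (N s \<omega>)))
       * indicator {0<..T} s \<partial>lborel \<partial>M)" (is "_ = ?R")
    if [measurable]: "\<And>n. (\<lambda>s. f s n) \<in> borel_measurable borel" "\<And>n. (\<lambda>s. h s n) \<in> borel_measurable borel"
    for f h
  proof -
    have "?R = (\<integral>\<^sup>+\<omega>. (\<integral>\<^sup>+s. ennreal (f s (N s \<omega>)) * indicator {0<..T} s \<partial>lborel) +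
        (\<integral>\<^sup>+s. ennreal (h s (N s \<omega>)) * ennreal (L s (N s \<omega>)) * indicator {0<..T} s \<partial>lborel) \<partial>M)"
    proof (rule nn_integral_cong)
      fix \<omega> assume "\<omega> \<in> space M"
      then have "(\<lambda>s. ennreal (f s (N s \<omega>)) * indicator {0<..T} s) \<in> borel_measurable lborel"
        "(\<lambda>s. ennreal (h s (N s \<omega>)) * ennreal (L s (N s \<omega>)) * indicator {0<..T} s) \<in> borel_measurable lborel"
        using sect[of "\<lambda>s n. ennreal (f s n) * indicator {0<..T} s" \<omega>]
          sect[of "\<lambda>s n. ennreal (h s n) * ennreal (L s n) * indicator {0<..T} s" \<omega>] by simp_all
      then show "(\<integral>\<^sup>+s. (ennreal (f s (N s \<omega>)) + ennreal (h s (N s \<omega>)) * ennreal (L s (N s \<omega>)))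
          * indicator {0<..T} s \<partial>lborel) = (\<integral>\<^sup>+s. ennreal (f s (N s \<omega>)) * indicator {0<..T} s \<partial>lborel) +
        (\<integral>\<^sup>+s. ennreal (h s (N s \<omega>)) * ennreal (L s (N s \<omega>)) * indicator {0<..T} s \<partial>lborel)"
        by (simp only: distrib_right nn_integral_add)
    qed
    also have "\<dots> = I f + J h"
      using int[of "\<lambda>s n. ennreal (f s n) * indicator {0<..T} s"]
        int[of "\<lambda>s n. ennreal (h s n) * ennreal (L s n) * indicator {0<..T} s"]
      unfolding I_def J_def by (intro nn_integral_add) simp_all
    finally show ?thesis by simp
  qed

  let ?c = "\<integral>\<^sup>+s\<in>{0<..T}. ennreal (c s) \<partial>lborel"
  have "I a + J d \<le> (\<integral>\<^sup>+\<omega>. (\<integral>\<^sup>+s. (ennreal (- a s (N s \<omega>)) + ennreal (- d s (N s \<omega>)) * ennreal (L s (N s \<omega>)))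
       * indicator {0<..T} s \<partial>lborel) + ?c \<partial>M)"
    unfolding IJ[of a d, simplified]
  proof (rule nn_integral_mono)
    fix \<omega> assume "\<omega> \<in> space M"
    then have meas: "(\<lambda>s. (ennreal (- a s (N s \<omega>)) + ennreal (- d s (N s \<omega>)) * ennreal (L s (N s \<omega>)))
        * indicator {0<..T} s) \<in> borel_measurable lborel"
      using sect[of "\<lambda>s n. (ennreal (- a s n) + ennreal (- d s n) * ennreal (L s n)) * indicator {0<..T} s" \<omega>]
      by simp
    have "(ennreal (a s n) + ennreal (d s n) * ennreal (L s n)) * indicator {0<..T} s \<le>
       (ennreal (- a s n) + ennreal (- d s n) * ennreal (L s n)) * indicator {0<..T} s + ennreal (c s) * indicator {0<..T} s"
      for s n
    proof (cases "s \<in> {0<..T}")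
      case True
      note L = nonneg(2)[OF True, of n] and c = nonneg(3)[OF True]
      \<comment> \<open>The signed drift bound is rearranged so that both sides are nonnegative and
        survive the passage to \<open>ennreal\<close>.\<close>
      have "max 0 (d s n) * L s n - max 0 (- d s n) * L s n = L s n * d s n"
        by (auto simp: max_def)
      then have "max 0 (a s n) + max 0 (d s n) * L s n \<le> max 0 (- a s n) + max 0 (- d s n) * L s n + c s"
        using drift[OF True, of n] unfolding d_def by linarith
      then have "ennreal (max 0 (a s n) + max 0 (d s n) * L s n)
          \<le> ennreal (max 0 (- a s n) + max 0 (- d s n) * L s n + c s)"
        by (rule ennreal_leI)
      then show ?thesis
        using True L c by (simp add: ennreal_mult)
    qed simp
    then have "(\<integral>\<^sup>+s. (ennreal (a s (N s \<omega>)) + ennreal (d s (N s \<omega>)) * ennreal (L s (N s \<omega>)))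
         * indicator {0<..T} s \<partial>lborel) \<le>
       (\<integral>\<^sup>+s. (ennreal (- a s (N s \<omega>)) + ennreal (- d s (N s \<omega>)) * ennreal (L s (N s \<omega>)))
         * indicator {0<..T} s + ennreal (c s) * indicator {0<..T} s \<partial>lborel)"
      by (intro nn_integral_mono)
    also have "\<dots> = (\<integral>\<^sup>+s. (ennreal (- a s (N s \<omega>)) + ennreal (- d s (N s \<omega>)) * ennreal (L s (N s \<omega>)))
         * indicator {0<..T} s \<partial>lborel) + ?c"
      by (intro nn_integral_add meas) measurable
    finally show "(\<integral>\<^sup>+s. (ennreal (a s (N s \<omega>)) + ennreal (d s (N s \<omega>)) * ennreal (L s (N s \<omega>)))
         * indicator {0<..T} s \<partial>lborel) \<le>
       (\<integral>\<^sup>+s. (ennreal (- a s (N s \<omega>)) + ennreal (- d s (N s \<omega>)) * ennreal (L s (N s \<omega>)))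
         * indicator {0<..T} s \<partial>lborel) + ?c" .
  qed
  also have "\<dots> = (I (\<lambda>s n. - a s n) + J (\<lambda>s n. - d s n)) + ?c"
    unfolding IJ[of "\<lambda>s n. - a s n" "\<lambda>s n. - d s n", simplified]
    using int[of "\<lambda>s n. (ennreal (- a s n) + ennreal (- d s n) * ennreal (L s n)) * indicator {0<..T} s"]
    by (subst nn_integral_add) (auto simp: emeasure_space_1)
  finally have le: "I a + J d \<le> (I (\<lambda>s n. - a s n) + J (\<lambda>s n. - d s n)) + ?c" .

  have "I (\<lambda>s n. - a s n) \<le> (\<integral>\<^sup>+\<omega>. ennreal (A * T) \<partial>M)"
    unfolding I_def by (intro nn_integral_mono bound_A)
  then have "I (\<lambda>s n. - a s n) < \<infinity>"
    by (auto simp: emeasure_space_1 intro: le_less_trans)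
  \<comment> \<open>\<open>L\<close> carries no upper bound, so the compensated form gives no
    estimate. The identity is read backwards: as a sum over the points, at most \<open>K\<close>
    terms are nonzero, each at most \<open>D\<close>.\<close>
  moreover have "J (\<lambda>s n. - d s n) < \<infinity>"
  proof -
    have "?D' \<omega> \<le> of_nat K * ennreal D" if "\<omega> \<in> space M" for \<omega>
    proof -
      let ?S = "S \<omega> \<inter> {0<..T}"
      let ?h = "\<lambda>n. if n < K then ennreal D else 0"
      have "?D' \<omega> = (\<Sum>p\<in>?S. ennreal (- d p (N p \<omega>)) * indicator {0<..T} p)"
        using finite[OF that] by (intro nn_integral_count_space') auto
      also have "\<dots> \<le> (\<Sum>p\<in>?S. ?h (card (?S \<inter> {..<p})))"
      proof (rule sum_mono)
        fix p assume p: "p \<in> ?S"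
        then have "?S \<inter> {..<p} = S \<omega> \<inter> {0<..<p}" by auto
        then have N: "card (?S \<inter> {..<p}) = N p \<omega>" by (simp add: N_def count_before_def)
        have "\<bar>d p (N p \<omega>)\<bar> \<le> (if N p \<omega> < K then D else 0)"
          using bound_d[of p "N p \<omega>"] p by (simp add: d_def)
        then show "ennreal (- d p (N p \<omega>)) * indicator {0<..T} p \<le> ?h (card (?S \<inter> {..<p}))"
          using p unfolding N by (auto intro!: ennreal_leI split: if_splits)
      qed
      also have "\<dots> = (\<Sum>n<card ?S. ?h n)"
        by (intro sum_card_less_eq finite that)
      also have "\<dots> = (\<Sum>n\<in>{..<card ?S} \<inter> {..<K}. ennreal D)"
        by (subst sum.inter_restrict) auto
      also have "\<dots> \<le> (\<Sum>n\<in>{..<K}. ennreal D)"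
        by (intro sum_mono2) auto
      finally show ?thesis by simp
    qed
    then have "integral\<^sup>N M ?D' \<le> (\<integral>\<^sup>+\<omega>. of_nat K * ennreal D \<partial>M)"
      by (intro nn_integral_mono)
    also have "\<dots> < \<infinity>"
      by (simp add: emeasure_space_1 ennreal_mult_less_top of_nat_less_top)
    finally show ?thesis
      using J[of "\<lambda>s n. - d s n"] by simp
  qed
  ultimately have fin: "I (\<lambda>s n. - a s n) + J (\<lambda>s n. - d s n) < \<infinity>" by simp
  \<comment> \<open>The same finite negative part now stands on both sides and cancels.\<close>
  have "(I (\<lambda>s n. - a s n) + J (\<lambda>s n. - d s n)) + integral\<^sup>N M ?g \<le>
      (I (\<lambda>s n. - a s n) + J (\<lambda>s n. - d s n)) + (ennreal (G 0 0) + ?c)"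
    using balance add_left_mono[OF le, of "ennreal (G 0 0)"] by (simp add: ac_simps)
  then show ?thesis
    using fin by (auto simp: ennreal_add_left_cancel_le)
qed

subsection \<open>The second moment\<close>

text \<open>With \<open>u\<close> = t + 1, \<open>z\<close> = Z and \<open>l\<close> the intensity,
  the left side is the drift of the weighted square divided by the weight. The cross term 2 z (l -
  x) costs at most 2 \<alpha> z^2 / u, leaving - (1 - \<alpha>) z^2 / u to absorb the \<alpha> |z| /
  u contained in \<open>l\<close>.\<close>

lemma drift_bound:
  fixes \<alpha> x u z l :: real
  assumes \<alpha>: "0 < \<alpha>" "\<alpha> < 1" and u: "1 \<le> u" and l: "\<bar>l - x\<bar> \<le> \<alpha> * \<bar>z / u\<bar>"
  shows "l * (2 * z + 1) - 2 * x * z - (1 + \<alpha>) * z\<^sup>2 / u \<le> x + 1 / (4 * (1 - \<alpha>))"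
proof -
  define w where "w = \<bar>z\<bar>"
  have zz: "z\<^sup>2 = w * w" by (simp add: w_def power2_eq_square)
  have l': "\<bar>l - x\<bar> \<le> \<alpha> * w / u"
    using l u by (simp add: w_def abs_divide)
  have "z * (l - x) \<le> w * \<bar>l - x\<bar>"
    unfolding w_def by (metis abs_ge_self abs_mult)
  also have "\<dots> \<le> w * (\<alpha> * w / u)"
    using l' by (intro mult_left_mono) (auto simp: w_def)
  finally have 1: "z * (l - x) \<le> \<alpha> * (w * w) / u" by (simp add: mult_ac)
  have 2: "l \<le> x + \<alpha> * w / u" using l' by linarith
  \<comment> \<open>Completing the square: the maximum of \<alpha> w - (1 - \<alpha>) w^2 is
    \<alpha>^2 / (4 (1 - \<alpha>)), attained where this square vanishes.\<close>
  have "0 \<le> (2 * (1 - \<alpha>) * w - \<alpha>)\<^sup>2" by simp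
  then have "4 * (1 - \<alpha>) * (\<alpha> * w - (1 - \<alpha>) * (w * w)) \<le> \<alpha>\<^sup>2"
    by (simp add: power2_eq_square algebra_simps)
  also have "\<dots> \<le> 1" using \<alpha> by (simp add: power_le_one)
  finally have 3: "\<alpha> * w - (1 - \<alpha>) * (w * w) \<le> 1 / (4 * (1 - \<alpha>))"
    using \<alpha> by (simp add: pos_le_divide_eq mult_ac)
  have "(\<alpha> * w - (1 - \<alpha>) * (w * w)) / u \<le> (1 / (4 * (1 - \<alpha>))) / u"
    using 3 u by (intro divide_right_mono) auto
  also have "\<dots> \<le> 1 / (4 * (1 - \<alpha>)) / 1"
    using u \<alpha> by (intro divide_left_mono) auto
  finally have 4: "(\<alpha> * w - (1 - \<alpha>) * (w * w)) / u \<le> 1 / (4 * (1 - \<alpha>))" by simp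
  have "l * (2 * z + 1) - 2 * x * z - (1 + \<alpha>) * z\<^sup>2 / u = 2 * (z * (l - x)) + l - (1 + \<alpha>) * (w * w) / u"
    by (simp add: zz algebra_simps)
  also have "\<dots> \<le> 2 * (\<alpha> * (w * w) / u) + (x + \<alpha> * w / u) - (1 + \<alpha>) * (w * w) / u"
    using 1 2 by linarith
  also have "\<dots> = x + (\<alpha> * w - (1 - \<alpha>) * (w * w)) / u"
    using u by (simp add: field_simps)
  also have "\<dots> \<le> x + 1 / (4 * (1 - \<alpha>))"
    using 4 by simp
  finally show ?thesis .
qed

lemma has_derivative_shifted_powr:
  fixes s e :: real
  assumes "0 \<le> s"
  shows "((\<lambda>s. (s + 1) powr e) has_real_derivative e * ((s + 1) powr e / (s + 1))) (at s)"
  using assms by (auto intro!: derivative_eq_intros simp: powr_diff)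

text \<open>The bound is the integral over the whole half line, hence uniform in
  \<open>T\<close>.\<close>

lemma nn_integral_powr_bound:
  fixes \<alpha> C T :: real
  assumes "0 < \<alpha>" "0 \<le> C" "0 \<le> T"
  shows "(\<integral>\<^sup>+s\<in>{0<..T}. ennreal (C * (s + 1) powr (- (1 + \<alpha>))) \<partial>lborel) \<le> ennreal (C / \<alpha>)"
proof -
  have deriv: "((\<lambda>s. - (C / \<alpha>) * (s + 1) powr (- \<alpha>)) has_real_derivative C * (s + 1) powr (- (1 + \<alpha>))) (at s)"
    if "0 \<le> s" for s
  proof -
    have "(s + 1) powr (- (1 + \<alpha>)) = (s + 1) powr (- \<alpha>) / (s + 1)"
      using that powr_diff[of "s + 1" "- \<alpha>" 1] by (simp add: minus_diff_commute)
    then show ?thesis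
      using assms DERIV_cmult[OF has_derivative_shifted_powr[OF that, of "- \<alpha>"], of "- (C / \<alpha>)"]
      by (simp add: mult.assoc)
  qed
  have "(\<integral>\<^sup>+s\<in>{0<..T}. ennreal (C * (s + 1) powr (- (1 + \<alpha>))) \<partial>lborel) \<le>
      (\<integral>\<^sup>+s\<in>{0..T}. ennreal (C * (s + 1) powr (- (1 + \<alpha>))) \<partial>lborel)"
    by (intro nn_integral_mono) (auto simp: indicator_def)
  also have "\<dots> = ennreal (- (C / \<alpha>) * (T + 1) powr (- \<alpha>) - (- (C / \<alpha>) * (0 + 1) powr (- \<alpha>)))"
    using assms deriv by (intro nn_integral_FTC_Icc) auto
  also have "\<dots> \<le> ennreal (C / \<alpha>)"
    using assms by (intro ennreal_leI) auto
  finally show ?thesis .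
qed

text \<open>The first constant is the square of Z at time 0, where the weight is 1; the second is
  the constant of the drift bound times 1 / \<alpha>, the integral of the weight over the half
  line.\<close>

lemma second_moment_bound:
  fixes M :: "'a measure" and S :: "'a \<Rightarrow> real set" and rate :: "real \<Rightarrow> real" and \<alpha> \<gamma> x T :: real
  assumes proc: "self_exciting_process M rate \<gamma> S" and \<gamma>: "0 \<le> \<gamma>" and \<alpha>: "0 < \<alpha>" "\<alpha> < 1" and x: "0 \<le> x"
    and rate: "mono_on {0..} rate" "\<And>y. 0 \<le> y \<Longrightarrow> 0 \<le> rate y"
    and contr: "\<And>y. 0 \<le> y \<Longrightarrow> \<bar>rate y - x\<bar> \<le> \<alpha> * \<bar>y - x\<bar>" and T: "0 \<le> T"
  shows "(\<integral>\<^sup>+\<omega>. ennreal ((real (count_upto S T \<omega>) + \<gamma> - x * (T + 1))\<^sup>2 * (T + 1) powr (- (1 + \<alpha>))) \<partial>M)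
    \<le> ennreal ((\<gamma> - x)\<^sup>2 + (x + 1 / (4 * (1 - \<alpha>))) / \<alpha>)"
proof -
  have M: "prob_space M" and S: "simple_point_process M S"
    and int: "has_intensity M (natural_filtration M S) S
      (\<lambda>t \<omega>. rate ((real (count_before S t \<omega>) + \<gamma>) / (t + 1)))"
    using proc by (auto simp: self_exciting_process_def)
  interpret prob_space M by fact
  have [measurable]: "count_upto S t \<in> measurable M (count_space UNIV)" for t
    using S by (simp add: simple_point_process_def)
  (* Capping the count at K makes everything bounded. It keeps the drift estimate because the time
     derivative at the cap is nonpositive once K >= x (T + 1). *)
  define C where "C = x + 1 / (4 * (1 - \<alpha>))"
  have C: "0 \<le> C" using x \<alpha> by (simp add: C_def)
  define z where "z s n = real n + \<gamma> - x * (s + 1)" for s n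
  define F where "F s n = (z s n)\<^sup>2 * (s + 1) powr (- (1 + \<alpha>))" for s n
  define f where "f s n = - 2 * x * z s n * (s + 1) powr (- (1 + \<alpha>))
      - (1 + \<alpha>) * (z s n)\<^sup>2 / (s + 1) * (s + 1) powr (- (1 + \<alpha>))" for s n
  \<comment> \<open>Nothing is known of \<open>rate\<close> at negative arguments. With
    \<open>max 0\<close> it becomes monotone on the whole line, hence Borel; at times
    \<open>s > 0\<close> the truncation changes nothing since \<gamma> \<ge> 0.\<close>
  define L where "L s n = rate (max 0 ((real n + \<gamma>) / (s + 1)))" for s n
  define c where "c s = C * (s + 1) powr (- (1 + \<alpha>))" for s
  let ?B = "(\<gamma> - x)\<^sup>2 + C / \<alpha>"
  have bound: "(\<integral>\<^sup>+\<omega>. ennreal (F T (min (count_upto S T \<omega>) K)) \<partial>M) \<le> ennreal ?B"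
    if K: "x * (T + 1) \<le> real K" "0 < K" for K
  proof -
    define R where "R = real K + \<gamma> + x * (T + 1)"
    have R: "0 \<le> R" using \<gamma> x T by (simp add: R_def)
    have zR: "\<bar>z s n\<bar> \<le> R" if "s \<in> {0..T}" "n \<le> K" for s n
    proof -
      have "x * (s + 1) \<le> x * (T + 1)" "0 \<le> x * (s + 1)"
        using that x by (auto intro: mult_left_mono)
      then show ?thesis using that \<gamma> by (auto simp: z_def R_def)
    qed
    have p1: "(s + 1) powr (- (1 + \<alpha>)) \<le> 1" if "s \<in> {0..T}" for s
      using that \<alpha> powr_mono[of "- (1 + \<alpha>)" 0 "s + 1"] by simp
    have "(\<integral>\<^sup>+\<omega>. ennreal (F T (min (count_upto S T \<omega>) K)) \<partial>M) \<le>
      ennreal (F 0 (min 0 K)) + (\<integral>\<^sup>+s\<in>{0<..T}. ennreal (c s) \<partial>lborel)"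
    proof (rule dynkin_inequality[where G="\<lambda>s n. F s (min n K)" and a="\<lambda>s n. f s (min n K)" and L=L
          and A="2 * x * R + (1 + \<alpha>) * R\<^sup>2" and K=K and D="2 * R + 1", OF M S T])
      fix C :: "real \<times> 'a \<Rightarrow> ennreal"
      assume "C \<in> borel_measurable (predictable_algebra (space M) (natural_filtration M S))"
      with int have "(\<integral>\<^sup>+\<omega>. (\<integral>\<^sup>+s. C (s, \<omega>) \<partial>count_space (S \<omega>)) \<partial>M) =
        (\<integral>\<^sup>+\<omega>. (\<integral>\<^sup>+s\<in>{0<..}. C (s, \<omega>) * ennreal (rate ((real (count_before S s \<omega>) + \<gamma>) / (s + 1))) \<partial>lborel) \<partial>M)"
        unfolding has_intensity_def by blast
      also have "\<dots> = (\<integral>\<^sup>+\<omega>. (\<integral>\<^sup>+s\<in>{0<..}. C (s, \<omega>) * ennreal (L s (count_before S s \<omega>)) \<partial>lborel) \<partial>M)"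
        using \<gamma> by (intro nn_integral_cong) (auto simp: indicator_def L_def max_def)
      finally show "(\<integral>\<^sup>+\<omega>. (\<integral>\<^sup>+s. C (s, \<omega>) \<partial>count_space (S \<omega>)) \<partial>M) =
        (\<integral>\<^sup>+\<omega>. (\<integral>\<^sup>+s\<in>{0<..}. C (s, \<omega>) * ennreal (L s (count_before S s \<omega>)) \<partial>lborel) \<partial>M)" .
    next
      fix s n assume s: "s \<in> {0..T}"
      let ?m = "min n K"
      have "((\<lambda>s. F s ?m) has_real_derivative f s ?m) (at s)"
      proof -
        have "((\<lambda>s. (z s ?m)\<^sup>2) has_real_derivative - 2 * x * z s ?m) (at s)"
          unfolding z_def by (auto intro!: derivative_eq_intros simp: algebra_simps)
        moreover have "0 \<le> s" using s by auto
        ultimately show ?thesis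
          unfolding F_def f_def
          by (intro DERIV_cong[OF DERIV_mult[OF _ has_derivative_shifted_powr]]) (auto simp: algebra_simps diff_divide_distrib add_divide_distrib)
      qed
      then show "((\<lambda>s. F s ?m) has_real_derivative f s ?m) (at s within {0..T})"
        by (rule has_field_derivative_at_within)
      let ?p = "(s + 1) powr (- (1 + \<alpha>))"
      have z: "\<bar>z s ?m\<bar> \<le> R" using s by (intro zR) auto
      have "\<bar>f s ?m\<bar> \<le> \<bar>2 * x * z s ?m * ?p\<bar> + \<bar>(1 + \<alpha>) * (z s ?m)\<^sup>2 / (s + 1) * ?p\<bar>"
        using abs_triangle_ineq4[of "- 2 * x * z s ?m * ?p" "(1 + \<alpha>) * (z s ?m)\<^sup>2 / (s + 1) * ?p"]
        by (simp add: f_def abs_mult)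
      also have "\<bar>2 * x * z s ?m * ?p\<bar> = 2 * x * \<bar>z s ?m\<bar> * ?p"
        using x by (simp add: abs_mult)
      also have "\<dots> \<le> 2 * x * R * 1"
        using x z p1[OF s] R by (intro mult_mono) auto
      also have "\<bar>(1 + \<alpha>) * (z s ?m)\<^sup>2 / (s + 1) * ?p\<bar> = (1 + \<alpha>) * \<bar>z s ?m\<bar>\<^sup>2 * (1 / (s + 1)) * ?p"
        using \<alpha> s by (simp add: abs_mult)
      also have "\<dots> \<le> (1 + \<alpha>) * R\<^sup>2 * 1 * 1"
        using \<alpha> s z p1[OF s] by (intro mult_mono power_mono) auto
      finally show "\<bar>f s ?m\<bar> \<le> 2 * x * R + (1 + \<alpha>) * R\<^sup>2" by simp
    next
      fix s n assume s: "s \<in> {0<..T}"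
      then have s': "s \<in> {0..T}" by auto
      let ?p = "(s + 1) powr (- (1 + \<alpha>))"
      have d: "F s (min (Suc n) K) - F s (min n K) = (if n < K then (2 * z s n + 1) * ?p else 0)"
        by (auto simp: F_def z_def power2_eq_square algebra_simps min_def)
      show "\<bar>F s (min (Suc n) K) - F s (min n K)\<bar> \<le> (if n < K then 2 * R + 1 else 0)"
      proof (cases "n < K")
        case True
        have "\<bar>(2 * z s n + 1) * ?p\<bar> = \<bar>2 * z s n + 1\<bar> * ?p" by (simp add: abs_mult)
        also have "\<dots> \<le> (2 * R + 1) * 1"
          using zR[OF s', of n] True p1[OF s'] R by (intro mult_mono) auto
        finally show ?thesis using True unfolding d by simp
      qed (simp add: d)
      show "f s (min n K) + L s n * (F s (min (Suc n) K) - F s (min n K)) \<le> c s"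
      proof (cases "n < K")
        case True
        have l: "L s n = rate ((real n + \<gamma>) / (s + 1))" and y: "0 \<le> (real n + \<gamma>) / (s + 1)"
          using s \<gamma> by (auto simp: L_def max_def)
        have "(real n + \<gamma>) / (s + 1) - x = z s n / (s + 1)"
          using s by (simp add: z_def field_simps)
        with contr[OF y] have "\<bar>L s n - x\<bar> \<le> \<alpha> * \<bar>z s n / (s + 1)\<bar>"
          by (simp add: l)
        from drift_bound[OF \<alpha> _ this] s
        have "L s n * (2 * z s n + 1) - 2 * x * z s n - (1 + \<alpha>) * (z s n)\<^sup>2 / (s + 1) \<le> C"
          by (simp add: C_def)
        then have "(L s n * (2 * z s n + 1) - 2 * x * z s n - (1 + \<alpha>) * (z s n)\<^sup>2 / (s + 1)) * ?p \<le> C * ?p"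
          by (rule mult_right_mono) simp
        moreover have "f s (min n K) + L s n * (F s (min (Suc n) K) - F s (min n K)) =
          (L s n * (2 * z s n + 1) - 2 * x * z s n - (1 + \<alpha>) * (z s n)\<^sup>2 / (s + 1)) * ?p"
          using True unfolding d by (simp add: f_def algebra_simps)
        ultimately show ?thesis by (simp add: c_def)
      next
        case False
        have "x * (s + 1) \<le> x * (T + 1)"
          using s x by (auto intro: mult_left_mono)
        then have "0 \<le> z s K"
          using K \<gamma> by (simp add: z_def)
        then have "0 \<le> x * z s K * ?p" "0 \<le> (1 + \<alpha>) * (z s K)\<^sup>2 / (s + 1) * ?p"
          using x \<alpha> s by auto
        then have "f s K \<le> 0" by (simp add: f_def)
        moreover have "0 \<le> c s" using C by (simp add: c_def)
        ultimately show ?thesis using False unfolding d by (simp add: min_def)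
      qed
    next
      fix n
      have "mono (\<lambda>y. rate (max 0 y))"
        using rate(1) by (auto simp: mono_def mono_on_def)
      from borel_measurable_mono[OF this]
      have [measurable]: "(\<lambda>y. rate (max 0 y)) \<in> borel_measurable borel" .
      show "(\<lambda>s. L s n) \<in> borel_measurable borel"
        unfolding L_def by measurable
      show "(\<lambda>s. f s (min n K)) \<in> borel_measurable borel" "(\<lambda>s. F s (min n K)) \<in> borel_measurable borel"
        unfolding f_def F_def z_def by measurable
    next
      show "c \<in> borel_measurable borel"
        unfolding c_def by measurable
    qed (use C rate in \<open>auto simp: F_def L_def c_def\<close>)
    also have "F 0 (min 0 K) = (\<gamma> - x)\<^sup>2"
      by (simp add: F_def z_def)
    also have "(\<integral>\<^sup>+s\<in>{0<..T}. ennreal (c s) \<partial>lborel) \<le> ennreal (C / \<alpha>)"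
      unfolding c_def by (intro nn_integral_powr_bound \<alpha> C T)
    finally show ?thesis
      using C \<alpha> by (simp add: add_left_mono)
  qed
  \<comment> \<open>Fatou's lemma in \<open>K\<close>: for each outcome the capped value is
    eventually the true one, and the bound does not depend on \<open>K\<close>.\<close>
  have "(\<integral>\<^sup>+\<omega>. ennreal (F T (count_upto S T \<omega>)) \<partial>M) =
      (\<integral>\<^sup>+\<omega>. liminf (\<lambda>K. ennreal (F T (min (count_upto S T \<omega>) K))) \<partial>M)"
  proof (rule nn_integral_cong)
    fix \<omega>
    have "(\<lambda>K. ennreal (F T (min (count_upto S T \<omega>) K))) \<longlonglongrightarrow> ennreal (F T (count_upto S T \<omega>))"
      by (rule tendsto_eventually)
        (auto simp: eventually_sequentially min_def intro!: exI[of _ "count_upto S T \<omega>"])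
    then show "ennreal (F T (count_upto S T \<omega>)) = liminf (\<lambda>K. ennreal (F T (min (count_upto S T \<omega>) K)))"
      by (intro lim_imp_Liminf[symmetric]) auto
  qed
  also have "\<dots> \<le> liminf (\<lambda>K. \<integral>\<^sup>+\<omega>. ennreal (F T (min (count_upto S T \<omega>) K)) \<partial>M)"
    by (rule nn_integral_liminf) measurable
  also have "\<dots> \<le> ennreal ?B"
  proof (rule Liminf_le)
    obtain K0 where K0: "x * (T + 1) \<le> real K0" using real_arch_simple by blast
    show "\<forall>\<^sub>F K in sequentially. (\<integral>\<^sup>+\<omega>. ennreal (F T (min (count_upto S T \<omega>) K)) \<partial>M) \<le> ennreal ?B"
      using eventually_ge_at_top[of "Suc K0"]
      by eventually_elim (use K0 in \<open>auto intro!: bound\<close>)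
  qed auto
  finally show ?thesis
    by (simp add: F_def z_def C_def)
qed

subsection \<open>Convergence of the ratio\<close>

text \<open>Monotonicity squeezes the ratio at \<open>t\<close> between ratios at neighbouring
  sampling times, up to the quotient of those times. For powers this quotient tends to 1, so nothing
  is lost in the limit.\<close>

lemma tendsto_ratio_of_subsequence:
  fixes N :: "real \<Rightarrow> nat" and x :: real and k :: nat
  assumes mono: "\<And>s t. s \<le> t \<Longrightarrow> N s \<le> N t" and k: "0 < k"
    and sub: "(\<lambda>n. real (N (real (Suc n) ^ k)) / real (Suc n) ^ k) \<longlonglongrightarrow> x"
  shows "((\<lambda>t. real (N t) / t) \<longlongrightarrow> x) at_top"
proof -
  define r where "r n = real (N (real (Suc n) ^ k)) / real (Suc n) ^ k" for n
  \<comment> \<open>The sampling times start at \<open>Suc 0\<close>, so the shift by 1 makes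
    \<open>Suc (m t)\<close> the integer part of the root for \<open>t \<ge> 1\<close>; then
    \<open>t\<close> lies between the sampling times of index \<open>m t\<close> and
    \<open>Suc (m t)\<close>.\<close>
  define m where "m t = nat \<lfloor>root k t\<rfloor> - 1" for t
  have "filterlim (\<lambda>t. root k t) at_top at_top"
    unfolding filterlim_at_top
  proof
    fix Z
    show "\<forall>\<^sub>F t in at_top. Z \<le> root k t"
      using eventually_ge_at_top[of "max 0 Z ^ k"]
    proof eventually_elim
      case (elim t)
      have "max 0 Z = root k (max 0 Z ^ k)" using k by (simp add: real_root_power_cancel)
      also have "\<dots> \<le> root k t" using elim k by (simp add: real_root_le_mono)
      finally show ?case by simp
    qed
  qed
  from filterlim_compose[OF filterlim_floor_sequentially this]
  have "filterlim (\<lambda>t. nat \<lfloor>root k t\<rfloor>) at_top at_top"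
    by (rule filterlim_compose[OF filterlim_nat_sequentially])
  then have m: "filterlim m at_top at_top"
    unfolding m_def by (rule filterlim_compose[OF filterlim_minus_const_nat_at_top])
  have q: "(\<lambda>n. (real (Suc (Suc n)) / real (Suc n)) ^ k) \<longlonglongrightarrow> 1 ^ k"
    by (intro tendsto_power) real_asymp
  have r: "r \<longlonglongrightarrow> x" "(\<lambda>n. r (Suc n)) \<longlonglongrightarrow> x"
    using sub LIMSEQ_Suc[OF sub] by (simp_all add: r_def[abs_def] del: of_nat_Suc)
  have lo: "(\<lambda>n. r n / (real (Suc (Suc n)) / real (Suc n)) ^ k) \<longlonglongrightarrow> x"
    using tendsto_divide[OF r(1) q] by simp
  have hi: "(\<lambda>n. r (Suc n) * (real (Suc (Suc n)) / real (Suc n)) ^ k) \<longlonglongrightarrow> x"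
    using tendsto_mult[OF r(2) q] by simp
  have ev: "\<forall>\<^sub>F t in at_top. r (m t) / (real (Suc (Suc (m t))) / real (Suc (m t))) ^ k \<le> real (N t) / t
      \<and> real (N t) / t \<le> r (Suc (m t)) * (real (Suc (Suc (m t))) / real (Suc (m t))) ^ k"
    using eventually_ge_at_top[of 1]
  proof eventually_elim
    case (elim t)
    let ?n = "m t"
    have "1 \<le> root k t" using elim k by simp
    then have fl: "real (Suc ?n) \<le> root k t" "root k t \<le> real (Suc (Suc ?n))"
      unfolding m_def by linarith+
    have "real (Suc ?n) ^ k \<le> root k t ^ k" "root k t ^ k \<le> real (Suc (Suc ?n)) ^ k"
      using fl elim by (auto intro!: power_mono simp del: of_nat_Suc)
    then have t: "real (Suc ?n) ^ k \<le> t" "t \<le> real (Suc (Suc ?n)) ^ k"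
      using elim k by (auto simp del: of_nat_Suc)
    have pos: "0 < real (Suc ?n) ^ k" "0 < real (Suc (Suc ?n)) ^ k" by simp_all
    have "r ?n / (real (Suc (Suc ?n)) / real (Suc ?n)) ^ k =
        real (N (real (Suc ?n) ^ k)) / real (Suc (Suc ?n)) ^ k"
      using pos by (simp add: r_def power_divide del: of_nat_Suc)
    also have "\<dots> \<le> real (N t) / t"
      using mono[OF t(1)] t elim by (intro frac_le) auto
    finally have 1: "r ?n / (real (Suc (Suc ?n)) / real (Suc ?n)) ^ k \<le> real (N t) / t" .
    have "real (N t) / t \<le> real (N (real (Suc (Suc ?n)) ^ k)) / real (Suc ?n) ^ k"
      using mono[OF t(2)] t(1) pos by (intro frac_le) auto
    also have "\<dots> = r (Suc ?n) * (real (Suc (Suc ?n)) / real (Suc ?n)) ^ k"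
      using pos by (simp add: r_def power_divide del: of_nat_Suc)
    finally show ?case using 1 by simp
  qed
  show ?thesis
    by (rule tendsto_sandwich[OF eventually_mono[OF ev] eventually_mono[OF ev]
          filterlim_compose[OF lo m] filterlim_compose[OF hi m]]) auto
qed

lemma contraction_fixed_point:
  fixes rate :: "real \<Rightarrow> real"
  assumes lip: "\<alpha>-lipschitz_on {0..} rate" and \<alpha>: "\<alpha> < 1" and nonneg: "\<And>y. 0 \<le> y \<Longrightarrow> 0 \<le> rate y"
  obtains x where "0 \<le> x" "rate x = x" "fixed_point rate = ereal x"
proof -
  have "\<exists>!x. x \<in> {0..} \<and> rate x = x"
    using assms lipschitz_on_nonneg[OF lip]
    by (intro Banach_fix[of _ \<alpha>]) (auto simp: complete_eq_closed lipschitz_on_def)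
  then have ex1: "\<exists>!x. 0 \<le> x \<and> x = rate x" by (auto simp: eq_commute)
  from theI'[OF this] have "0 \<le> (THE x. 0 \<le> x \<and> x = rate x)"
    "(THE x. 0 \<le> x \<and> x = rate x) = rate (THE x. 0 \<le> x \<and> x = rate x)" by auto
  with ex1 show thesis
    by (intro that[of "THE x. 0 \<le> x \<and> x = rate x"]) (auto simp: fixed_point_def)
qed

text \<open>From here on the intensity no longer appears: both modes of convergence are consequences
  of the weighted moment bound for a simple point process.\<close>

context
  fixes M :: "'a measure" and S :: "'a \<Rightarrow> real set" and \<alpha> \<gamma> x B :: real
  assumes M: "prob_space M" and S: "simple_point_process M S"
    and \<alpha>: "0 < \<alpha>" "\<alpha> < 1" and B: "0 \<le> B"
    and moment: "\<And>T. 0 \<le> T \<Longrightarrow> (\<integral>\<^sup>+\<omega>. ennreal ((real (count_upto S T \<omega>) + \<gamma> - x * (T + 1))\<^sup>2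
      * (T + 1) powr (- (1 + \<alpha>))) \<partial>M) \<le> ennreal B"
begin

interpretation prob_space M by fact

lemma count_upto_measurable[measurable]: "count_upto S t \<in> measurable M (count_space UNIV)"
  using S by (simp add: simple_point_process_def)

lemma mean_square_deviation:
  assumes T: "0 \<le> T"
  shows "(\<integral>\<^sup>+\<omega>. ennreal (((real (count_upto S T \<omega>) + \<gamma>) / (T + 1) - x)\<^sup>2) \<partial>M)
    \<le> ennreal (B * (T + 1) powr (\<alpha> - 1))"
proof -
  let ?z = "\<lambda>\<omega>. real (count_upto S T \<omega>) + \<gamma> - x * (T + 1)"
  let ?p = "(T + 1) powr (- (1 + \<alpha>))" and ?q = "(T + 1) powr (\<alpha> - 1)"
  \<comment> \<open>Normalising Z by T + 1 brings in the power - 2, of which the weight accounts for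
    - (1 + \<alpha>); the remaining exponent \<alpha> - 1 is negative and gives the rate of
    decay.\<close>
  have "?q * ?p = (T + 1) powr (- 2)"
    by (simp flip: powr_add)
  also have "\<dots> = 1 / (T + 1)\<^sup>2"
    using T by (simp add: powr_minus_divide)
  finally have pq: "?q * ?p = 1 / (T + 1)\<^sup>2" .
  have "((real (count_upto S T \<omega>) + \<gamma>) / (T + 1) - x)\<^sup>2 = ?q * ((?z \<omega>)\<^sup>2 * ?p)" for \<omega>
  proof -
    have "(real (count_upto S T \<omega>) + \<gamma>) / (T + 1) - x = ?z \<omega> / (T + 1)"
      using T by (simp add: field_simps)
    then have "((real (count_upto S T \<omega>) + \<gamma>) / (T + 1) - x)\<^sup>2 = (?z \<omega>)\<^sup>2 * (1 / (T + 1)\<^sup>2)"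
      by (simp add: power_divide)
    then show ?thesis
      unfolding pq[symmetric] by (simp add: mult_ac)
  qed
  then have "(\<integral>\<^sup>+\<omega>. ennreal (((real (count_upto S T \<omega>) + \<gamma>) / (T + 1) - x)\<^sup>2) \<partial>M) =
      (\<integral>\<^sup>+\<omega>. ennreal ?q * ennreal ((?z \<omega>)\<^sup>2 * ?p) \<partial>M)"
    by (simp add: ennreal_mult)
  also have "\<dots> = ennreal ?q * (\<integral>\<^sup>+\<omega>. ennreal ((?z \<omega>)\<^sup>2 * ?p) \<partial>M)"
    by (rule nn_integral_cmult) measurable
  also have "\<dots> \<le> ennreal ?q * ennreal B"
    by (intro mult_left_mono moment T) simp
  also have "\<dots> = ennreal (B * ?q)"
    using B by (simp add: ennreal_mult mult.commute)
  finally show ?thesis .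
qed

lemma ratio_converges_in_prob:
  "converges_in_prob M (\<lambda>t \<omega>. real (count_upto S t \<omega>) / t) (ereal x)"
  unfolding converges_in_prob_def ereal.case
proof (intro allI impI)
  fix \<epsilon> :: real assume \<epsilon>: "0 < \<epsilon>"
  let ?Y = "\<lambda>t \<omega>. (real (count_upto S t \<omega>) + \<gamma>) / (t + 1) - x"
  \<comment> \<open>For such \<open>t\<close>, passing from N / t to (N + \<gamma>) / (t + 1) costs
    at most half of the deviation: more than \<epsilon> before forces at least \<epsilon> / 2 after.
    The factor \<open>4 / \<epsilon>\<^sup>2\<close> below is the inverse square of \<epsilon> /
    2.\<close>
  have "\<forall>\<^sub>F t in at_top. \<bar>\<gamma>\<bar> + \<bar>x\<bar> + \<epsilon> / 2 \<le> \<epsilon> / 2 * t"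
    using \<epsilon> by real_asymp
  then have upper: "\<forall>\<^sub>F t in at_top. measure M {\<omega> \<in> space M. \<bar>real (count_upto S t \<omega>) / t - x\<bar> > \<epsilon>} \<le>
      4 / \<epsilon>\<^sup>2 * (B * (t + 1) powr (\<alpha> - 1))"
    using eventually_gt_at_top[of 0]
  proof eventually_elim
    case (elim t)
    let ?E = "{\<omega> \<in> space M. \<bar>real (count_upto S t \<omega>) / t - x\<bar> > \<epsilon>}"
    have "?E \<subseteq> {\<omega> \<in> space M. 1 \<le> ennreal (4 / \<epsilon>\<^sup>2) * ennreal ((?Y t \<omega>)\<^sup>2)}"
    proof safe
      fix \<omega> assume "\<epsilon> < \<bar>real (count_upto S t \<omega>) / t - x\<bar>"
      moreover have "real (count_upto S t \<omega>) / t - x = (real (count_upto S t \<omega>) - x * t) / t"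
        using elim by (simp add: field_simps)
      ultimately have "\<epsilon> * t < \<bar>real (count_upto S t \<omega>) - x * t\<bar>"
        using elim by (simp add: abs_divide field_simps)
      then have "\<epsilon> / 2 * (t + 1) \<le> \<bar>real (count_upto S t \<omega>) + \<gamma> - x * (t + 1)\<bar>"
      proof -
        have "real (count_upto S t \<omega>) + \<gamma> - x * (t + 1) = (real (count_upto S t \<omega>) - x * t) + (\<gamma> - x)"
          by (simp add: algebra_simps)
        moreover have "\<epsilon> / 2 * (t + 1) + \<bar>\<gamma>\<bar> + \<bar>x\<bar> \<le> \<epsilon> * t"
        proof -
          have "\<epsilon> / 2 * (t + 1) = \<epsilon> / 2 * t + \<epsilon> / 2" "\<epsilon> * t = \<epsilon> / 2 * t + \<epsilon> / 2 * t"
            by (simp_all add: distrib_left)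
          then show ?thesis using elim(1) by linarith
        qed
        ultimately show ?thesis
          using \<open>\<epsilon> * t < \<bar>real (count_upto S t \<omega>) - x * t\<bar>\<close> by linarith
      qed
      moreover have "?Y t \<omega> = (real (count_upto S t \<omega>) + \<gamma> - x * (t + 1)) / (t + 1)"
        using elim by (simp add: field_simps)
      ultimately have "\<epsilon> / 2 \<le> \<bar>?Y t \<omega>\<bar>"
        using elim by (simp add: abs_divide pos_le_divide_eq)
      then have "(\<epsilon> / 2)\<^sup>2 \<le> (?Y t \<omega>)\<^sup>2"
        using \<epsilon> by (subst abs_le_square_iff[symmetric]) auto
      then have "1 \<le> 4 / \<epsilon>\<^sup>2 * (?Y t \<omega>)\<^sup>2"
        using \<epsilon> by (simp add: power_divide field_simps)
      then have "ennreal 1 \<le> ennreal (4 / \<epsilon>\<^sup>2 * (?Y t \<omega>)\<^sup>2)" by (rule ennreal_leI)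
      then show "1 \<le> ennreal (4 / \<epsilon>\<^sup>2) * ennreal ((?Y t \<omega>)\<^sup>2)"
        by (subst ennreal_mult[symmetric]) auto
    qed
    then have "emeasure M ?E \<le> emeasure M {\<omega> \<in> space M. 1 \<le> ennreal (4 / \<epsilon>\<^sup>2) * ennreal ((?Y t \<omega>)\<^sup>2)}"
      by (intro emeasure_mono) measurable
    also have "\<dots> \<le> ennreal (4 / \<epsilon>\<^sup>2) * (\<integral>\<^sup>+\<omega>. ennreal ((?Y t \<omega>)\<^sup>2) \<partial>M)"
    proof -
      have "emeasure M ({\<omega> \<in> space M. 1 \<le> ennreal (4 / \<epsilon>\<^sup>2) * ennreal ((?Y t \<omega>)\<^sup>2)}) \<le>
          ennreal (4 / \<epsilon>\<^sup>2) * (\<integral>\<^sup>+\<omega>\<in>space M. ennreal ((?Y t \<omega>)\<^sup>2) \<partial>M)"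
        by (rule nn_integral_Markov_inequality) measurable
      also have "(\<integral>\<^sup>+\<omega>\<in>space M. ennreal ((?Y t \<omega>)\<^sup>2) \<partial>M) = (\<integral>\<^sup>+\<omega>. ennreal ((?Y t \<omega>)\<^sup>2) \<partial>M)"
        by (intro nn_integral_cong) simp
      finally show ?thesis .
    qed
    also have "\<dots> \<le> ennreal (4 / \<epsilon>\<^sup>2) * ennreal (B * (t + 1) powr (\<alpha> - 1))"
      using elim by (intro mult_left_mono mean_square_deviation) auto
    also have "\<dots> = ennreal (4 / \<epsilon>\<^sup>2 * (B * (t + 1) powr (\<alpha> - 1)))"
      using B by (intro ennreal_mult[symmetric]) auto
    finally have "ennreal (measure M ?E) \<le> ennreal (4 / \<epsilon>\<^sup>2 * (B * (t + 1) powr (\<alpha> - 1)))"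
      by (simp add: emeasure_eq_measure)
    then show ?case
      using B by (subst (asm) ennreal_le_iff) auto
  qed
  have "((\<lambda>t. 4 / \<epsilon>\<^sup>2 * (B * (t + 1) powr (\<alpha> - 1))) \<longlongrightarrow> 4 / \<epsilon>\<^sup>2 * (B * 0)) at_top"
    using \<alpha> by (intro tendsto_mult tendsto_const) real_asymp
  then show "((\<lambda>t. measure M {\<omega> \<in> space M. \<bar>real (count_upto S t \<omega>) / t - x\<bar> > \<epsilon>}) \<longlongrightarrow> 0) at_top"
    by (intro tendsto_sandwich[OF _ upper tendsto_const]) auto
qed

lemma ratio_converges_AE:
  "AE \<omega> in M. ((\<lambda>t. real (count_upto S t \<omega>) / t) \<longlongrightarrow> x) at_top"
proof -
  obtain k where k: "2 / (1 - \<alpha>) \<le> real k" using real_arch_simple by blast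
  have "0 < 2 / (1 - \<alpha>)" using \<alpha> by simp
  with k have k0: "0 < k" by (cases k) auto
  have k2: "2 \<le> real k * (1 - \<alpha>)" using k \<alpha> by (simp add: field_simps)
  define t where "t n = real (Suc n) ^ k" for n
  have t0: "0 < t n" for n by (simp add: t_def)
  let ?Y = "\<lambda>n \<omega>. (real (count_upto S (t n) \<omega>) + \<gamma>) / (t n + 1) - x"
  have bound: "(\<integral>\<^sup>+\<omega>. ennreal ((?Y n \<omega>)\<^sup>2) \<partial>M) \<le> ennreal (B * (1 / (real (Suc n))\<^sup>2))" for n
  proof -
    have "(t n + 1) powr (\<alpha> - 1) \<le> t n powr (\<alpha> - 1)"
      using \<alpha> t0[of n] by (intro powr_mono2') auto
    also have "\<dots> = real (Suc n) powr (real k * (\<alpha> - 1))"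
      by (simp add: t_def powr_powr powr_realpow[symmetric] del: of_nat_Suc)
    also have "\<dots> \<le> real (Suc n) powr (- 2)"
      using k2 by (intro powr_mono) (auto simp: algebra_simps)
    also have "\<dots> = 1 / (real (Suc n))\<^sup>2"
      by (simp add: powr_minus_divide del: of_nat_Suc)
    finally have "ennreal (B * (t n + 1) powr (\<alpha> - 1)) \<le> ennreal (B * (1 / (real (Suc n))\<^sup>2))"
      using B by (intro ennreal_leI mult_left_mono)
    with mean_square_deviation[of "t n"] t0[of n] show ?thesis
      by (meson order_trans less_imp_le)
  qed
  have summable: "summable (\<lambda>n. B * (1 / (real (Suc n))\<^sup>2))"
    using inverse_power_summable[of 2, where 'a=real]
    by (intro summable_mult) (subst summable_Suc_iff, simp add: inverse_eq_divide)
  \<comment> \<open>In place of a Borel-Cantelli argument for each \<epsilon>: the sum of all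
    squared deviations has finite expectation, so it is almost surely finite and its terms tend to
    0.\<close>
  have "(\<integral>\<^sup>+\<omega>. (\<Sum>n. ennreal ((?Y n \<omega>)\<^sup>2)) \<partial>M) = (\<Sum>n. \<integral>\<^sup>+\<omega>. ennreal ((?Y n \<omega>)\<^sup>2) \<partial>M)"
    by (rule nn_integral_suminf) measurable
  also have "\<dots> \<le> (\<Sum>n. ennreal (B * (1 / (real (Suc n))\<^sup>2)))"
    by (intro suminf_le bound) auto
  also have "\<dots> = ennreal (\<Sum>n. B * (1 / (real (Suc n))\<^sup>2))"
    using B by (intro suminf_ennreal2 summable) auto
  also have "\<dots> < \<infinity>" by simp
  finally have "(\<integral>\<^sup>+\<omega>. (\<Sum>n. ennreal ((?Y n \<omega>)\<^sup>2)) \<partial>M) \<noteq> \<infinity>" by simp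
  then have "AE \<omega> in M. (\<Sum>n. ennreal ((?Y n \<omega>)\<^sup>2)) \<noteq> \<infinity>"
    by (intro nn_integral_PInf_AE) measurable
  then show ?thesis
    using AE_space
  proof eventually_elim
    case (elim \<omega>)
    have fin: "finite (S \<omega> \<inter> {0<..s})" for s
      using S elim(2) by (auto simp: simple_point_process_def)
    have "summable (\<lambda>n. (?Y n \<omega>)\<^sup>2)"
      using elim(1) by (intro summable_suminf_not_top) auto
    then have "(\<lambda>n. (?Y n \<omega>)\<^sup>2) \<longlonglongrightarrow> 0" by (rule summable_LIMSEQ_zero)
    then have "(\<lambda>n. ?Y n \<omega>) \<longlonglongrightarrow> 0"
      using tendsto_real_sqrt[of "\<lambda>n. (?Y n \<omega>)\<^sup>2" 0] by (simp add: tendsto_rabs_zero_iff)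
    moreover have "(\<lambda>n. 1 / t n) \<longlonglongrightarrow> 0"
      unfolding t_def using k0 by real_asymp
    \<comment> \<open>This undoes the shift by \<gamma> and 1: N / t equals ((N + \<gamma>) / (t +
      1)) (1 + 1 / t) - \<gamma> / t.\<close>
    ultimately have "(\<lambda>n. (?Y n \<omega> + x) * (1 + 1 / t n) - \<gamma> * (1 / t n)) \<longlonglongrightarrow> (0 + x) * (1 + 0) - \<gamma> * 0"
      by (intro tendsto_intros)
    moreover have "(?Y n \<omega> + x) * (1 + 1 / t n) - \<gamma> * (1 / t n) = real (count_upto S (t n) \<omega>) / t n" for n
    proof -
      have "1 + 1 / t n = (t n + 1) / t n" using t0[of n] by (simp add: field_simps)
      then have "(?Y n \<omega> + x) * (1 + 1 / t n) = (real (count_upto S (t n) \<omega>) + \<gamma>) / t n"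
        using t0[of n] by simp
      then show ?thesis by (simp add: add_divide_distrib)
    qed
    ultimately have "(\<lambda>n. real (count_upto S (t n) \<omega>) / t n) \<longlonglongrightarrow> x" by simp
    then show ?case
      unfolding t_def
      by (intro tendsto_ratio_of_subsequence[OF _ k0])
        (auto simp: count_upto_def intro!: card_mono fin)
  qed
qed

end

theorem theorem1:
  fixes M :: "'a measure" and S :: "'a \<Rightarrow> real set"
    and rate :: "real \<Rightarrow> real" and \<alpha> \<gamma> :: real
  assumes "admissible_rate rate"
    and "0 \<le> \<gamma>"
    and "self_exciting_process M rate \<gamma> S"
    and "0 < \<alpha>" and "\<alpha> < 1"
    and "\<alpha>-lipschitz_on {0..} rate"
  shows "converges_in_prob M (\<lambda>t \<omega>. real (count_upto S t \<omega>) / t) (fixed_point rate) \<and>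
    ((\<exists>C\<^sub>0. \<forall>x\<ge>0. rate x \<le> C\<^sub>0) \<longrightarrow>
      (AE \<omega> in M. ((\<lambda>t. ereal (real (count_upto S t \<omega>) / t)) \<longlongrightarrow> fixed_point rate) at_top))"
proof -
  have rate: "mono_on {0..} rate" "\<And>y. 0 \<le> y \<Longrightarrow> 0 \<le> rate y"
    using assms(1) by (auto simp: admissible_rate_def)
  obtain x where x: "0 \<le> x" "rate x = x" "fixed_point rate = ereal x"
    using contraction_fixed_point[OF assms(6,5) rate(2)] .
  have contr: "\<bar>rate y - x\<bar> \<le> \<alpha> * \<bar>y - x\<bar>" if "0 \<le> y" for y
    using lipschitz_onD[OF assms(6), of y x] that x by (simp add: dist_real_def)
  have M: "prob_space M" and S: "simple_point_process M S"
    using assms(3) by (auto simp: self_exciting_process_def)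
  note moment = second_moment_bound[OF assms(3,2,4,5) x(1) rate contr]
  have B: "0 \<le> (\<gamma> - x)\<^sup>2 + (x + 1 / (4 * (1 - \<alpha>))) / \<alpha>"
    using x(1) assms(4,5) by simp
  show ?thesis
    using ratio_converges_in_prob[OF M S assms(4,5) B moment]
      ratio_converges_AE[OF M S assms(4,5) B moment]
    by (simp add: x(3))
qed

end
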